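(* Let $G$ be a group of order $n$, where $n$ is a square-free positive integer. Then \[G\otimes G \cong \mathbb{Z}_{n}.\]
   Context: $G\otimes G$ denotes the non-abelian tensor square of $G$: the group generated by symbols $g\otimes h$ ($g,h\in G$) subject to the relations \[g_1g\otimes h=({}^{g_1}g\otimes {}^{g_1}h)(g_1\otimes h),\qquad g\otimes h_1h=(g\otimes h_1)({}^{h_1}g\otimes {}^{h_1}h)\] for all $g,g_1,h,h_1\in G$, where ${}^{x}y=xyx^{-1}$. $\mathbb{Z}_n$ denotes the cyclic group of order $n$. *)

theory Defs
  imports
    "HOL-Algebra.Group"
    "HOL-Algebra.Coset"
    "HOL-Algebra.Elementary_Groups"
    "HOL-Computational_Algebra.Squarefree"
begin

text \<open>
  Words over \<open>X\<close> and formal inverses: the letter \<open>(True, x)\<close> stands for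
  \<open>x\<close>, the letter \<open>(False, x)\<close> for the formal inverse of \<open>x\<close>.
\<close>

type_synonym 'x gword = "(bool \<times> 'x) list"

definition gwords :: "'x set \<Rightarrow> 'x gword set" where
  "gwords X = lists (UNIV \<times> X)"

abbreviation gen :: "'x \<Rightarrow> bool \<times> 'x" where
  "gen x \<equiv> (True, x)"

text \<open>
  A relation \<open>u = v\<close> is represented by the pair \<open>(u, v)\<close>.  The following is the least
  congruence on the monoid of words that cancels adjacent mutually inverse letters and
  identifies the two sides of every relation.
\<close>

inductive pres_eq :: "'x set \<Rightarrow> ('x gword \<times> 'x gword) set \<Rightarrow> 'x gword \<Rightarrow> 'x gword \<Rightarrow> bool"
  for X :: "'x set" and R :: "('x gword \<times> 'x gword) set"
where
  refl: "w \<in> gwords X \<Longrightarrow> pres_eq X R w w"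
| sym: "pres_eq X R u v \<Longrightarrow> pres_eq X R v u"
| trans: "pres_eq X R u v \<Longrightarrow> pres_eq X R v w \<Longrightarrow> pres_eq X R u w"
| append: "pres_eq X R u u' \<Longrightarrow> pres_eq X R v v' \<Longrightarrow> pres_eq X R (u @ v) (u' @ v')"
| cancel: "x \<in> X \<Longrightarrow> pres_eq X R [(b, x), (\<not> b, x)] []"
| rel: "(u, v) \<in> R \<Longrightarrow> u \<in> gwords X \<Longrightarrow> v \<in> gwords X \<Longrightarrow> pres_eq X R u v"

definition pres_class :: "'x set \<Rightarrow> ('x gword \<times> 'x gword) set \<Rightarrow> 'x gword \<Rightarrow> 'x gword set" where
  "pres_class X R w = {v. pres_eq X R w v}"

definition presented_group ::
  "'x set \<Rightarrow> ('x gword \<times> 'x gword) set \<Rightarrow> 'x gword set monoid" where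
  "presented_group X R =
    \<lparr> carrier = gwords X // {(u, v). pres_eq X R u v},
      monoid.mult = (\<lambda>A B. \<Union>a\<in>A. \<Union>b\<in>B. pres_class X R (a @ b)),
      one = pres_class X R [] \<rparr>"

definition conj_by :: "('a, 'b) monoid_scheme \<Rightarrow> 'a \<Rightarrow> 'a \<Rightarrow> 'a" where
  "conj_by G x y = x \<otimes>\<^bsub>G\<^esub> y \<otimes>\<^bsub>G\<^esub> inv\<^bsub>G\<^esub> x"

text \<open>The generator \<open>(g, h)\<close> stands for the symbol \<open>g \<otimes> h\<close>.\<close>

definition tensor_relations ::
  "('a, 'b) monoid_scheme \<Rightarrow> (('a \<times> 'a) gword \<times> ('a \<times> 'a) gword) set" where
  "tensor_relations G =
    {([gen (g1 \<otimes>\<^bsub>G\<^esub> g, h)], [gen (conj_by G g1 g, conj_by G g1 h), gen (g1, h)]) | g1 g h.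
       g1 \<in> carrier G \<and> g \<in> carrier G \<and> h \<in> carrier G} \<union>
    {([gen (g, h1 \<otimes>\<^bsub>G\<^esub> h)], [gen (g, h1), gen (conj_by G h1 g, conj_by G h1 h)]) | g h1 h.
       g \<in> carrier G \<and> h1 \<in> carrier G \<and> h \<in> carrier G}"

definition tensor_square :: "('a, 'b) monoid_scheme \<Rightarrow> ('a \<times> 'a) gword set monoid" where
  "tensor_square G = presented_group (carrier G \<times> carrier G) (tensor_relations G)"

lemma pres_eq_gwords: "pres_eq X R u v \<Longrightarrow> u \<in> gwords X \<and> v \<in> gwords X"
  by (induction rule: pres_eq.induct) (auto simp: gwords_def)

lemma pres_class_eq_iff:
  assumes "v \<in> gwords X"
  shows "pres_class X R u = pres_class X R v \<longleftrightarrow> pres_eq X R u v"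
proof
  assume "pres_class X R u = pres_class X R v"
  with assms have "v \<in> pres_class X R u" by (simp add: pres_class_def pres_eq.refl)
  then show "pres_eq X R u v" by (simp add: pres_class_def)
next
  assume "pres_eq X R u v"
  then have "pres_eq X R u w \<longleftrightarrow> pres_eq X R v w" for w
    by (meson pres_eq.sym pres_eq.trans)
  then show "pres_class X R u = pres_class X R v" by (simp add: pres_class_def)
qed

lemma carrier_presented_group:
  "carrier (presented_group X R) = pres_class X R ` gwords X"
  by (auto simp: presented_group_def quotient_def pres_class_def)

lemma one_presented_group: "\<one>\<^bsub>presented_group X R\<^esub> = pres_class X R []"
  by (simp add: presented_group_def)

lemma mult_presented_group:
  assumes "u \<in> gwords X" "v \<in> gwords X"
  shows "pres_class X R u \<otimes>\<^bsub>presented_group X R\<^esub> pres_class X R v = pres_class X R (u @ v)"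
proof -
  have "pres_class X R (a @ b) = pres_class X R (u @ v)"
    if "a \<in> pres_class X R u" "b \<in> pres_class X R v" for a b
  proof -
    have "pres_eq X R (a @ b) (u @ v)"
      using that by (simp add: pres_class_def pres_eq.append pres_eq.sym)
    then show ?thesis
      using assms by (subst pres_class_eq_iff) (simp_all add: gwords_def)
  qed
  moreover have "u \<in> pres_class X R u" "v \<in> pres_class X R v"
    using assms by (simp_all add: pres_class_def pres_eq.refl)
  ultimately have "(\<Union>a\<in>pres_class X R u. \<Union>b\<in>pres_class X R v. pres_class X R (a @ b)) =
      pres_class X R (u @ v)"
    by blast
  then show ?thesis by (simp add: presented_group_def)
qed

lemma pres_eq_inverse:
  "w \<in> gwords X \<Longrightarrow> pres_eq X R (rev (map (\<lambda>(b, x). (\<not> b, x)) w) @ w) []"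
proof (induction w)
  case Nil
  then show ?case by (simp add: pres_eq.refl)
next
  case (Cons a w)
  obtain b x where a: "a = (b, x)" by fastforce
  let ?v = "rev (map (\<lambda>(b, x). (\<not> b, x)) w)"
  have w: "w \<in> gwords X" "x \<in> X" using Cons.prems by (auto simp: gwords_def a)
  then have v: "?v \<in> gwords X" by (auto simp: gwords_def)
  have "pres_eq X R ([(\<not> b, x), (b, x)] @ w) ([] @ w)"
    using pres_eq.cancel[OF w(2), of R "\<not> b"] w by (intro pres_eq.append) (simp_all add: pres_eq.refl)
  then have "pres_eq X R (?v @ [(\<not> b, x), (b, x)] @ w) (?v @ w)"
    using v by (simp add: pres_eq.append pres_eq.refl)
  then have "pres_eq X R (?v @ [(\<not> b, x), (b, x)] @ w) []"
    using Cons.IH[OF w(1)] by (rule pres_eq.trans)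
  then show ?case by (simp add: a)
qed

lemma group_presented_group: "group (presented_group X R)"
proof (rule groupI)
  fix x assume "x \<in> carrier (presented_group X R)"
  then obtain w where w: "w \<in> gwords X" "x = pres_class X R w"
    by (auto simp: carrier_presented_group)
  let ?v = "rev (map (\<lambda>(b, x). (\<not> b, x)) w)"
  have v: "?v \<in> gwords X" using w by (auto simp: gwords_def)
  have "pres_class X R ?v \<otimes>\<^bsub>presented_group X R\<^esub> x = \<one>\<^bsub>presented_group X R\<^esub>"
    using v w pres_eq_inverse[OF w(1), of R] pres_class_eq_iff[of "[]" X R]
    by (simp add: mult_presented_group one_presented_group) (simp add: gwords_def)
  then show "\<exists>y\<in>carrier (presented_group X R).
      y \<otimes>\<^bsub>presented_group X R\<^esub> x = \<one>\<^bsub>presented_group X R\<^esub>"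
    using v by (auto simp: carrier_presented_group)
next
  have nil: "[] \<in> gwords X" by (simp add: gwords_def)
  then show "\<one>\<^bsub>presented_group X R\<^esub> \<in> carrier (presented_group X R)"
    by (auto simp: carrier_presented_group one_presented_group)
  have app: "u @ v \<in> gwords X" if "u \<in> gwords X" "v \<in> gwords X" for u v
    using that by (simp add: gwords_def)
  fix x y z
  assume "x \<in> carrier (presented_group X R)"
  then obtain u where u: "u \<in> gwords X" "x = pres_class X R u"
    by (auto simp: carrier_presented_group)
  show "\<one>\<^bsub>presented_group X R\<^esub> \<otimes>\<^bsub>presented_group X R\<^esub> x = x"
    using mult_presented_group[OF nil u(1), of R] by (simp add: u one_presented_group)
  assume "y \<in> carrier (presented_group X R)"
  then obtain v where v: "v \<in> gwords X" "y = pres_class X R v"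
    by (auto simp: carrier_presented_group)
  show "x \<otimes>\<^bsub>presented_group X R\<^esub> y \<in> carrier (presented_group X R)"
    using u v app by (auto simp: carrier_presented_group mult_presented_group)
  assume "z \<in> carrier (presented_group X R)"
  then obtain w where w: "w \<in> gwords X" "z = pres_class X R w"
    by (auto simp: carrier_presented_group)
  show "x \<otimes>\<^bsub>presented_group X R\<^esub> y \<otimes>\<^bsub>presented_group X R\<^esub> z =
      x \<otimes>\<^bsub>presented_group X R\<^esub> (y \<otimes>\<^bsub>presented_group X R\<^esub> z)"
    using u v w app by (simp add: mult_presented_group)
qed

lemma presented_group_relation:
  assumes "(u, v) \<in> R" "u \<in> gwords X" "v \<in> gwords X"
  shows "pres_class X R u = pres_class X R v"
  using assms by (simp add: pres_class_eq_iff pres_eq.rel)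

fun word_eval :: "('h, 'c) monoid_scheme \<Rightarrow> ('x \<Rightarrow> 'h) \<Rightarrow> 'x gword \<Rightarrow> 'h" where
  "word_eval H f [] = \<one>\<^bsub>H\<^esub>"
| "word_eval H f ((b, x) # w) = (if b then f x else inv\<^bsub>H\<^esub> (f x)) \<otimes>\<^bsub>H\<^esub> word_eval H f w"

lemma presented_group_universal:
  assumes "group H" and f: "f \<in> X \<rightarrow> carrier H"
    and R: "\<And>u v. (u, v) \<in> R \<Longrightarrow> word_eval H f u = word_eval H f v"
  shows "\<exists>\<phi>\<in>hom (presented_group X R) H. \<forall>x\<in>X. \<phi> (pres_class X R [gen x]) = f x"
proof -
  interpret H: group H by fact
  have closed: "word_eval H f w \<in> carrier H" if "w \<in> gwords X" for w
    using that f by (induction w) (auto simp: gwords_def Pi_iff)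
  have app: "word_eval H f (u @ v) = word_eval H f u \<otimes>\<^bsub>H\<^esub> word_eval H f v"
    if "u \<in> gwords X" "v \<in> gwords X" for u v
    using that(1)
  proof (induction u)
    case Nil
    then show ?case using closed that by simp
  next
    case (Cons a u)
    then have "u \<in> gwords X" "snd a \<in> X" by (auto simp: gwords_def)
    then show ?case using Cons.IH closed that f by (cases a) (auto simp: H.m_assoc Pi_iff)
  qed
  have eq: "word_eval H f u = word_eval H f v" if "pres_eq X R u v" for u v
    using that
  proof (induction rule: pres_eq.induct)
    case (append u u' v v')
    then show ?case using pres_eq_gwords[of X R] app by metis
  next
    case (cancel x b)
    then have "f x \<in> carrier H" using f by auto
    then show ?case by simp
  qed (use R in auto)
  define \<phi> where "\<phi> A = word_eval H f (SOME w. w \<in> A)" for A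
  have \<phi>: "\<phi> (pres_class X R w) = word_eval H f w" if "w \<in> gwords X" for w
  proof -
    have "w \<in> pres_class X R w" using that by (simp add: pres_class_def pres_eq.refl)
    then have "(SOME v. v \<in> pres_class X R w) \<in> pres_class X R w" by (rule someI)
    then show ?thesis using eq by (simp add: \<phi>_def pres_class_def)
  qed
  have "\<phi> \<in> hom (presented_group X R) H"
  proof (rule homI)
    fix x assume "x \<in> carrier (presented_group X R)"
    then show "\<phi> x \<in> carrier H" using closed \<phi> by (auto simp: carrier_presented_group)
  next
    fix x y assume "x \<in> carrier (presented_group X R)" "y \<in> carrier (presented_group X R)"
    then obtain u v where "u \<in> gwords X" "x = pres_class X R u" "v \<in> gwords X" "y = pres_class X R v"
      by (auto simp: carrier_presented_group)
    moreover from this have "u @ v \<in> gwords X" by (simp add: gwords_def)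
    ultimately show "\<phi> (x \<otimes>\<^bsub>presented_group X R\<^esub> y) = \<phi> x \<otimes>\<^bsub>H\<^esub> \<phi> y"
      by (simp add: mult_presented_group \<phi> app)
  qed
  moreover have "\<phi> (pres_class X R [gen x]) = f x" if "x \<in> X" for x
    using that f \<phi>[of "[gen x]"] by (auto simp: gwords_def Pi_iff)
  ultimately show ?thesis by blast
qed

lemma tensor_relations_gwords:
  assumes "group G" "(u, v) \<in> tensor_relations G"
  shows "u \<in> gwords (carrier G \<times> carrier G)" "v \<in> gwords (carrier G \<times> carrier G)"
proof -
  interpret group G by fact
  show "u \<in> gwords (carrier G \<times> carrier G)" "v \<in> gwords (carrier G \<times> carrier G)"
    using assms(2) by (auto simp: tensor_relations_def gwords_def conj_by_def)
qed

end

theory Submission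
  imports Defs
    "HOL-Algebra.Sylow"
    "HOL-Algebra.Multiplicative_Group"
    "HOL-Algebra.Generated_Groups"
    "HOL-Number_Theory.Residues"
begin

text \<open>
  Write \<open>T\<close> for the tensor square of \<open>G\<close>, \<open>G'\<close> for the derived subgroup, \<open>m\<close> for the order
  of \<open>G'\<close> and \<open>k\<close> for its index, so that \<open>n = k m\<close> with \<open>k\<close> and \<open>m\<close> coprime.

  The group \<open>T\<close> is large enough because it has two quotients of coprime orders: the commutator
  map \<open>g \<otimes> h \<mapsto> [g,h]\<close> sends \<open>T\<close> onto \<open>G'\<close>, and a homomorphism \<open>\<theta>\<close> of \<open>G\<close> onto the integers
  modulo \<open>k\<close>, which exists since the abelian group \<open>G/G'\<close> has squarefree order and is therefore
  cyclic, gives the map \<open>g \<otimes> h \<mapsto> \<theta> g \<theta> h\<close> onto the integers modulo \<open>k\<close>. Hence \<open>n\<close> divides the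
  order of \<open>T\<close>.

  For the upper bound, \<open>G'\<close> has to be cyclic, hence abelian. This is the classical fact that a
  group of squarefree order is metabelian (\<open>squarefree_order_imp_derived_comm\<close>). For the smallest
  prime divisor \<open>p\<close> of the order, a subgroup of order \<open>p\<close> commutes with everything that normalizes
  it, so the transfer to it is a nontrivial homomorphism and its kernel is a proper subgroup
  containing \<open>G'\<close>. By induction the second derived subgroup is abelian, hence cyclic. A cyclic
  normal subgroup is centralized by \<open>G'\<close>, because power automorphisms commute; so \<open>G'\<close> is a
  central extension of a cyclic group and therefore abelian.

  In \<open>T\<close>, conjugation by \<open>t\<close> acts on a symbol \<open>x \<otimes> y\<close> by conjugating both entries with the image
  of \<open>t\<close> under the commutator map (\<open>mult_pair\<close>). The kernel of that map is thus central, and as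
  its image \<open>G'\<close> is cyclic, \<open>T\<close> is abelian. Consequently \<open>G'\<close> acts trivially on the symbols, which
  makes them multiplicative in \<open>G'\<close> in either entry, trivial when both entries lie in \<open>G'\<close>, and
  antisymmetric when one does. With \<open>G = G' \<langle>b\<rangle>\<close> it follows that \<open>T\<close> consists of the products of
  some \<open>c \<otimes> b\<close>, \<open>c \<in> G'\<close>, with a power of \<open>b \<otimes> b\<close>, where the \<open>k\<close>-th power of \<open>b \<otimes> b\<close> is
  \<open>b^k \<otimes> b\<close> and so of the first kind. There are at most \<open>m k = n\<close> such products. So \<open>T\<close> is an
  abelian group of squarefree order \<open>n\<close>, and is cyclic.
\<close>

section \<open>Criteria for cyclic and commutative groups\<close>

lemma (in group) exists_ord_eq_prime:
  assumes "prime p" "p dvd order G" "finite (carrier G)"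
  obtains x where "x \<in> carrier G" "ord x = p"
proof -
  obtain m where "order G = p ^ 1 * m" using assms(2) by auto
  then obtain H where H: "subgroup H G" "card H = p ^ 1"
    using sylow_thm[of p G 1 m] assms is_group by auto
  interpret H: subgroup H G by fact
  have "\<not> H \<subseteq> {\<one>}"
    using H(2) assms(1) card_mono[of "{\<one>}" H] prime_ge_2_nat[of p] by fastforce
  then obtain x where x: "x \<in> H" "x \<noteq> \<one>" by blast
  interpret GH: group "G\<lparr>carrier := H\<rparr>" using H.subgroup_is_group is_group by blast
  have fin: "finite H" using assms(3) H.subset finite_subset by blast
  have "x [^]\<^bsub>G\<lparr>carrier := H\<rparr>\<^esub> card H = \<one>"
    using GH.pow_order_eq_1[of x] x fin by (simp add: order_def)
  then have "x [^] p = \<one>" using H(2) nat_pow_consistent[of x p H] by simp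
  then have "ord x dvd p" using x H.subset pow_eq_id by auto
  moreover have "ord x \<noteq> 1" using x H.subset ord_eq_1 by auto
  ultimately have "ord x = p" using assms(1) by (metis prime_nat_iff)
  then show ?thesis using that x H.subset by blast
qed

lemma (in comm_group) finprod_pow_eq_one:
  assumes "e \<in> A \<rightarrow> carrier G" "\<And>x. x \<in> A \<Longrightarrow> e x [^] (q::nat) = \<one>"
  shows "finprod G e A [^] q = \<one>"
  using assms
proof (induction A rule: infinite_finite_induct)
  case (insert x A)
  then have "e x \<in> carrier G" "finprod G e A \<in> carrier G" by auto
  then show ?case using insert by (auto simp: nat_pow_distrib Pi_iff)
qed auto

lemma (in group) ord_eq_order_imp_cyclic:
  assumes "x \<in> carrier G" "ord x = order G" "finite (carrier G)"
  shows "cyclic_group G"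
proof -
  have "generate G {x} \<subseteq> carrier G" using assms(1) generate_incl by auto
  moreover have "card (generate G {x}) = card (carrier G)"
    using generate_pow_card assms by (simp add: order_def)
  ultimately have "generate G {x} = carrier G" using assms(3) card_subset_eq by blast
  then have "carrier G = range (\<lambda>n::int. x [^] n)"
    using generate_pow[OF assms(1)] by (simp add: full_SetCompr_eq)
  then show ?thesis unfolding cyclic_group using assms(1) by blast
qed

text \<open>
  The product of one element of order \<open>p\<close> for each prime divisor \<open>p\<close> of the order is a generator:
  its power with exponent \<open>n/p\<close> only retains the factor of order \<open>p\<close>, and does not kill it.
\<close>

lemma (in comm_group) squarefree_order_imp_cyclic:
  assumes "finite (carrier G)" "squarefree (order G)"
  shows "cyclic_group G"
proof -
  define n where "n = order G"
  have n0: "n > 0" using assms(1) order_gt_0_iff_finite by (simp add: n_def)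
  define S where "S = prime_factors n"
  have "\<exists>x. x \<in> carrier G \<and> ord x = p" if "p \<in> S" for p
    using that exists_ord_eq_prime[of p] assms(1) unfolding S_def n_def by auto
  then obtain e where e: "\<And>p. p \<in> S \<Longrightarrow> e p \<in> carrier G \<and> ord (e p) = p" by metis
  define x where "x = finprod G e S"
  have x: "x \<in> carrier G" unfolding x_def using e by (intro finprod_closed) auto
  have ndvd: "\<not> ord x dvd n div p" if p: "p \<in> S" for p
  proof
    define q where "q = n div p"
    assume "ord x dvd n div p"
    then have "x [^] q = \<one>" using x pow_eq_id q_def by auto
    have pp: "prime p" and nq: "n = p * q" using p unfolding S_def q_def by auto
    have npq: "\<not> p dvd q"
    proof
      assume "p dvd q" then have "p ^ 2 dvd n" unfolding nq by (simp add: power2_eq_square)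
      then show False using assms(2) pp unfolding n_def squarefree_def by auto
    qed
    define r where "r = finprod G e (S - {p})"
    have rc: "r \<in> carrier G" unfolding r_def using e by (intro finprod_closed) auto
    have "r [^] q = \<one>" unfolding r_def
    proof (rule finprod_pow_eq_one)
      fix y assume y: "y \<in> S - {p}"
      then have "prime y" "y dvd p * q" using nq unfolding S_def by auto
      then have "y dvd q" using y pp by (metis DiffD2 insertI1 prime_dvd_mult_iff primes_dvd_imp_eq)
      then show "e y [^] q = \<one>" using e y pow_eq_id by auto
    qed (use e in auto)
    moreover have "x = e p \<otimes> r"
    proof -
      have "x = finprod G e (insert p (S - {p}))" using p by (simp add: x_def insert_absorb)
      also have "\<dots> = e p \<otimes> r" unfolding r_def
        using e p by (intro finprod_insert) (auto simp: S_def)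
      finally show ?thesis .
    qed
    ultimately have "e p [^] q = \<one>"
      using \<open>x [^] q = \<one>\<close> e[OF p] rc by (simp add: nat_pow_distrib)
    then show False using e[OF p] pow_eq_id npq by auto
  qed
  have "ord x dvd n" using ord_dvd_group_order[OF x] by (simp add: n_def)
  then obtain k where k: "n = ord x * k" by auto
  have "k = 1"
  proof (rule ccontr)
    assume "k \<noteq> 1"
    then obtain p where p: "prime p" "p dvd k" using prime_factor_nat by blast
    then obtain l where "k = p * l" by auto
    then have "n = p * (ord x * l)" using k by auto
    then have "p \<in> S" "n div p = ord x * l" using p n0 unfolding S_def by (auto simp: prime_factors_dvd)
    then show False using ndvd[of p] by simp
  qed
  then show ?thesis using ord_eq_order_imp_cyclic[OF x] assms(1) k n_def by auto
qed

text \<open>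
  Modulo the central kernel every element is a power of one fixed element \<open>t\<close>.
\<close>

lemma (in group_hom) cyclic_image_central_kernel_imp_comm:
  assumes "cyclic_group H" "h ` carrier G = carrier H"
    and cen: "\<And>z y. z \<in> kernel G H h \<Longrightarrow> y \<in> carrier G \<Longrightarrow> z \<otimes> y = y \<otimes> z"
  shows "comm_group G"
proof -
  obtain t where t: "t \<in> carrier G" "carrier H = range (\<lambda>n::int. h t [^]\<^bsub>H\<^esub> n)"
    using assms(1,2) unfolding H.cyclic_group by (metis imageE)
  have dec: "\<exists>z\<in>kernel G H h. \<exists>i::int. x = t [^] i \<otimes> z" if x: "x \<in> carrier G" for x
  proof -
    obtain i :: int where i: "h x = h t [^]\<^bsub>H\<^esub> i" using hom_closed[OF x] t(2) by auto
    have ti: "t [^] i \<in> carrier G" using t(1) by simp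
    have hti: "h (t [^] i) = h x" using i hom_int_pow t(1) by simp
    have "inv (t [^] i) \<otimes> x \<in> kernel G H h"
      using x ti hti by (simp add: kernel_def)
    moreover have "x = t [^] i \<otimes> (inv (t [^] i) \<otimes> x)" using x ti by (simp flip: G.m_assoc)
    ultimately show ?thesis by blast
  qed
  show ?thesis
  proof (rule G.group_comm_groupI)
    fix x y assume xy: "x \<in> carrier G" "y \<in> carrier G"
    obtain i :: int and z where x: "x = t [^] i \<otimes> z" "z \<in> kernel G H h" using dec xy by blast
    obtain j :: int and w where y: "y = t [^] j \<otimes> w" "w \<in> kernel G H h" using dec xy by blast
    have c: "z \<in> carrier G" "w \<in> carrier G" "t [^] i \<in> carrier G" "t [^] j \<in> carrier G"
      using x y t by (auto simp: kernel_def)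
    have tt: "t [^] i \<otimes> t [^] j = t [^] j \<otimes> t [^] i" using t(1)
      by (metis G.int_pow_mult add.commute)
    have "x \<otimes> y = t [^] i \<otimes> (z \<otimes> y)" using c xy by (simp add: x G.m_assoc)
    also have "\<dots> = t [^] i \<otimes> y \<otimes> z" using c xy cen[OF x(2)] by (simp add: G.m_assoc)
    also have "t [^] i \<otimes> y = y \<otimes> t [^] i"
      using c cen[OF y(2) c(3)] tt by (simp add: y G.m_assoc) (simp flip: G.m_assoc)
    finally show "x \<otimes> y = y \<otimes> x" using c xy by (simp add: x G.m_assoc)
  qed
qed

section \<open>Transfer to a subgroup without fusion\<close>

definition (in group) centralizer :: "'a set \<Rightarrow> 'a set" where
  "centralizer P = {x \<in> carrier G. \<forall>v\<in>P. x \<otimes> v = v \<otimes> x}"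

lemma (in group) centralizerD:
  "x \<in> centralizer P \<Longrightarrow> v \<in> P \<Longrightarrow> x \<otimes> v = v \<otimes> x"
  unfolding centralizer_def by blast

lemma (in group) subgroup_centralizer:
  assumes "P \<subseteq> carrier G" shows "subgroup (centralizer P) G"
proof (rule subgroupI)
  have "\<one> \<in> centralizer P" using assms by (auto simp: centralizer_def)
  then show "centralizer P \<noteq> {}" by blast
next
  fix a assume a: "a \<in> centralizer P"
  then have ac: "a \<in> carrier G" by (simp add: centralizer_def)
  have "inv a \<otimes> v = v \<otimes> inv a" if v: "v \<in> P" for v
  proof -
    have vc: "v \<in> carrier G" and av: "a \<otimes> v = v \<otimes> a" using a v assms by (auto simp: centralizer_def)
    have "inv a \<otimes> v = inv a \<otimes> (v \<otimes> a) \<otimes> inv a" using ac vc by (simp add: m_assoc)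
    also have "\<dots> = v \<otimes> inv a" using ac vc unfolding av[symmetric] by (simp flip: m_assoc)
    finally show ?thesis .
  qed
  then show "inv a \<in> centralizer P" using ac by (simp add: centralizer_def)
next
  fix a b assume ab: "a \<in> centralizer P" "b \<in> centralizer P"
  then have c: "a \<in> carrier G" "b \<in> carrier G" by (auto simp: centralizer_def)
  have "a \<otimes> b \<otimes> v = v \<otimes> (a \<otimes> b)" if v: "v \<in> P" for v
  proof -
    have vc: "v \<in> carrier G" and *: "a \<otimes> v = v \<otimes> a" "b \<otimes> v = v \<otimes> b" using ab v assms by (auto simp: centralizer_def)
    have "a \<otimes> b \<otimes> v = a \<otimes> (b \<otimes> v)" using c vc by (simp add: m_assoc)
    also have "\<dots> = (a \<otimes> v) \<otimes> b" unfolding *(2) using c vc by (simp add: m_assoc)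
    also have "\<dots> = v \<otimes> (a \<otimes> b)" unfolding *(1) using c vc by (simp add: m_assoc)
    finally show ?thesis .
  qed
  then show "a \<otimes> b \<in> centralizer P" using c by (simp add: centralizer_def)
qed (auto simp: centralizer_def)

text \<open>
  A map \<open>s\<close> from \<open>G\<close> to \<open>P\<close> that commutes with left multiplication by \<open>P\<close> amounts to a choice of
  representatives for the right cosets of \<open>P\<close>: those \<open>x\<close> with \<open>s x = \<one>\<close>. Absence of fusion means that
  \<open>P \<times> P\<close> acts freely on each double coset \<open>P d P\<close> outside the centralizer, which allows
  representatives there that are permuted by right multiplication with \<open>P\<close>. For this choice the
  transfer of an element of \<open>P\<close> can be read off coset by coset.
\<close>

lemma (in group) equivariant_section:
  assumes P: "subgroup P G" and PC: "P \<subseteq> centralizer P"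
    and fusion: "\<forall>u\<in>P - {\<one>}. \<forall>x\<in>carrier G. x \<otimes> u \<otimes> inv x \<in> P \<longrightarrow> x \<in> centralizer P"
  shows "\<exists>s. (\<forall>x\<in>carrier G. s x \<in> P) \<and>
    (\<forall>k\<in>P. \<forall>x\<in>carrier G. s (k \<otimes> x) = k \<otimes> s x) \<and>
    (\<forall>x\<in>centralizer P. \<forall>v\<in>P. s (x \<otimes> v) = v \<otimes> s x) \<and>
    (\<forall>x\<in>carrier G - centralizer P. \<forall>v\<in>P. s (x \<otimes> v) = s x)"
proof -
  interpret P: subgroup P G by fact
  let ?C = "centralizer P"
  interpret C: subgroup ?C G using subgroup_centralizer P.subset .
  \<comment> \<open>\<open>d x\<close> is a representative of the double coset of \<open>x\<close>, and \<open>h\<close> in \<open>x = h d r\<close> becomes the value of \<open>s\<close>.\<close>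
  define D where "D x = {h \<otimes> x \<otimes> r | h r. h \<in> P \<and> r \<in> P}" for x
  define d where "d x = (SOME y. y \<in> D x)" for x
  have undo: "x = inv h \<otimes> (h \<otimes> x \<otimes> r) \<otimes> inv r" if "h \<in> P" "r \<in> P" "x \<in> carrier G" for h x r
    using that by (simp add: m_assoc) (simp flip: m_assoc)
  have D_sub: "D (h \<otimes> x \<otimes> r) \<subseteq> D x" if "h \<in> P" "r \<in> P" "x \<in> carrier G" for h x r
  proof
    fix y assume "y \<in> D (h \<otimes> x \<otimes> r)"
    then obtain h' r' where y: "h' \<in> P" "r' \<in> P" "y = h' \<otimes> (h \<otimes> x \<otimes> r) \<otimes> r'" by (auto simp: D_def)
    then have "y = (h' \<otimes> h) \<otimes> x \<otimes> (r \<otimes> r')" using that by (simp add: m_assoc)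
    then show "y \<in> D x" using that y unfolding D_def by blast
  qed
  have D_eq: "D (h \<otimes> x \<otimes> r) = D x" if *: "h \<in> P" "r \<in> P" "x \<in> carrier G" for h x r
  proof
    show "D x \<subseteq> D (h \<otimes> x \<otimes> r)" using * D_sub[of "inv h" "inv r" "h \<otimes> x \<otimes> r"] undo[OF *] by simp
  qed (use * D_sub in auto)
  have dD: "d x \<in> D x" if x: "x \<in> carrier G" for x
  proof -
    have "x \<in> D x" unfolding D_def mem_Collect_eq
      using x by (intro exI[of _ "\<one>"] conjI) simp_all
    then show ?thesis unfolding d_def by (rule someI)
  qed
  have memC: "h \<otimes> x \<otimes> r \<in> ?C \<longleftrightarrow> x \<in> ?C" if *: "h \<in> P" "r \<in> P" "x \<in> carrier G" for h x r
  proof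
    assume "h \<otimes> x \<otimes> r \<in> ?C"
    then show "x \<in> ?C" using * PC undo[OF *] by (metis C.m_closed P.m_inv_closed subsetD)
  qed (use * PC in auto)
  define Q where "Q x h \<longleftrightarrow> h \<in> P \<and> (\<exists>r\<in>P. x = h \<otimes> d x \<otimes> r \<and> (x \<in> ?C \<longrightarrow> r = \<one>))" for x h
  have dc: "d x \<in> carrier G" if "x \<in> carrier G" for x using dD[OF that] that by (auto simp: D_def)
  have comm: "u \<otimes> v = v \<otimes> u" if "u \<in> P" "v \<in> ?C" for u v
    using centralizerD[OF that(2,1)] by simp
  have dC: "d x \<in> ?C \<longleftrightarrow> x \<in> ?C" if x: "x \<in> carrier G" for x
    using dD[OF x] memC x by (auto simp: D_def)
  have Q_ex: "\<exists>h. Q x h" if x: "x \<in> carrier G" for x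
  proof -
    obtain h r where hr: "h \<in> P" "r \<in> P" "d x = h \<otimes> x \<otimes> r" using dD[OF x] by (auto simp: D_def)
    have xe: "x = inv h \<otimes> d x \<otimes> inv r" using undo[OF hr(1,2) x] unfolding hr(3)[symmetric] .
    show ?thesis
    proof (cases "x \<in> ?C")
      case True
      then have "d x \<in> ?C" using dC x by simp
      then have "d x \<otimes> inv r = inv r \<otimes> d x" using comm[OF P.m_inv_closed[OF hr(2)]] by simp
      then have "x = (inv h \<otimes> inv r) \<otimes> d x \<otimes> \<one>"
        using xe hr dc[OF x] by (metis P.mem_carrier inv_closed m_assoc m_closed r_one)
      then show ?thesis unfolding Q_def using hr by (intro exI[of _ "inv h \<otimes> inv r"]) auto
    next
      case False
      then show ?thesis unfolding Q_def using hr xe by (intro exI[of _ "inv h"]) auto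
    qed
  qed
  have Q_unique: "h = h'" if x: "x \<in> carrier G" and q: "Q x h" "Q x h'" for x h h'
  proof -
    obtain r r' where r: "r \<in> P" "r' \<in> P" "x = h \<otimes> d x \<otimes> r" "x = h' \<otimes> d x \<otimes> r'"
      "x \<in> ?C \<longrightarrow> r = \<one>" "x \<in> ?C \<longrightarrow> r' = \<one>" using q unfolding Q_def by auto
    have h: "h \<in> P" "h' \<in> P" using q unfolding Q_def by auto
    let ?u = "r' \<otimes> inv r"
    have d: "d x \<in> carrier G" using dc x .
    have u: "?u \<in> P" using r by simp
    have "h \<otimes> d x = (h \<otimes> d x \<otimes> r) \<otimes> inv r" using r(1) h d by (simp add: m_assoc)
    also have "h \<otimes> d x \<otimes> r = h' \<otimes> d x \<otimes> r'" using r(3,4) by simp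
    also have "h' \<otimes> d x \<otimes> r' \<otimes> inv r = h' \<otimes> (d x \<otimes> ?u)" using r(1,2) h d by (simp add: m_assoc)
    finally have hd: "h \<otimes> d x = h' \<otimes> (d x \<otimes> ?u)" .
    have "d x \<otimes> ?u = inv h' \<otimes> (h \<otimes> d x)" using h u d unfolding hd by (simp flip: m_assoc)
    then have "d x \<otimes> ?u \<otimes> inv (d x) = inv h' \<otimes> h" using h d by (simp add: m_assoc)
    then have "d x \<otimes> ?u \<otimes> inv (d x) \<in> P" using h by simp
    \<comment> \<open>Two different values would make \<open>d x\<close> conjugate a nontrivial element of \<open>P\<close> into \<open>P\<close>.\<close>
    then have fu: "d x \<in> ?C" if "?u \<noteq> \<one>" using fusion u d that by blast
    have "?u = \<one>"
    proof (rule ccontr)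
      assume *: "?u \<noteq> \<one>"
      then have "r = \<one>" "r' = \<one>" using fu[OF *] r(5,6) dC[OF x] by auto
      then show False using * by simp
    qed
    then show ?thesis using hd h d by simp
  qed
  define s where "s x = (SOME h. Q x h)" for x
  have Qs: "Q x (s x)" if "x \<in> carrier G" for x unfolding s_def using Q_ex[OF that] by (rule someI_ex)
  have s_eq: "s x = h" if "x \<in> carrier G" "Q x h" for x h using Q_unique[OF that(1) Qs[OF that(1)] that(2)] .
  have d_inv: "d (h \<otimes> x \<otimes> r) = d x" if "h \<in> P" "r \<in> P" "x \<in> carrier G" for h x r
    unfolding d_def D_eq[OF that] ..
  have d_l: "d (h \<otimes> x) = d x" "h \<otimes> x \<in> ?C \<longleftrightarrow> x \<in> ?C" if "h \<in> P" "x \<in> carrier G" for h x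
    using d_inv[of h \<one> x] memC[of h \<one> x] that by auto
  have d_r: "d (x \<otimes> r) = d x" "x \<otimes> r \<in> ?C \<longleftrightarrow> x \<in> ?C" if "r \<in> P" "x \<in> carrier G" for r x
    using d_inv[of \<one> r x] memC[of \<one> r x] that by auto
  have sP: "s x \<in> P" if "x \<in> carrier G" for x using Qs[OF that] by (simp add: Q_def)
  have sl: "s (k \<otimes> x) = k \<otimes> s x" if k: "k \<in> P" and x: "x \<in> carrier G" for k x
  proof (rule s_eq)
    obtain r where r: "r \<in> P" "x = s x \<otimes> d x \<otimes> r" "x \<in> ?C \<longrightarrow> r = \<one>" using Qs[OF x] by (auto simp: Q_def)
    have "k \<otimes> x = k \<otimes> (s x \<otimes> d x \<otimes> r)" using r(2) by simp
    also have "\<dots> = (k \<otimes> s x) \<otimes> d x \<otimes> r" using r(1) k x dc sP by (simp add: m_assoc)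
    finally have "k \<otimes> x = (k \<otimes> s x) \<otimes> d x \<otimes> r" .
    then show "Q (k \<otimes> x) (k \<otimes> s x)" unfolding Q_def using d_l[OF k x] r k sP[OF x] by auto
  qed (use k x in auto)
  have sC: "s (x \<otimes> v) = v \<otimes> s x" if "x \<in> ?C" "v \<in> P" for x v
    using sl[OF that(2), of x] comm[OF that(2,1)] that(1) by auto
  have sN: "s (x \<otimes> v) = s x" if x: "x \<in> carrier G" "x \<notin> ?C" and v: "v \<in> P" for x v
  proof -
    obtain r where r: "r \<in> P" "x = s x \<otimes> d x \<otimes> r" using Qs[OF x(1)] by (auto simp: Q_def)
    have "x \<otimes> v = (s x \<otimes> d x \<otimes> r) \<otimes> v" using r(2) by simp
    also have "\<dots> = s x \<otimes> d x \<otimes> (r \<otimes> v)" using r(1) v x dc sP by (simp add: m_assoc)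
    finally have "x \<otimes> v = s x \<otimes> d x \<otimes> (r \<otimes> v)" .
    then have "Q (x \<otimes> v) (s x)" unfolding Q_def using d_r[OF v x(1)] r v x sP by auto
    then show ?thesis using s_eq x v by simp
  qed
  show ?thesis
  proof (intro exI[of _ s] conjI ballI)
    fix x assume "x \<in> carrier G" then show "s x \<in> P" by (rule sP)
  next
    fix k x assume "k \<in> P" "x \<in> carrier G" then show "s (k \<otimes> x) = k \<otimes> s x" by (rule sl)
  next
    fix x v assume "x \<in> ?C" "v \<in> P" then show "s (x \<otimes> v) = v \<otimes> s x" by (rule sC)
  next
    fix x v assume "x \<in> carrier G - ?C" "v \<in> P"
    then show "s (x \<otimes> v) = s x" using sN[of x v] by simp
  qed
qed

text \<open>
  \<open>V\<close> is the transfer from \<open>G\<close> to \<open>P\<close>. Each right coset of \<open>P\<close> inside the centralizer contributes a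
  factor \<open>u\<close> to \<open>V u\<close>, and all other cosets contribute \<open>\<one>\<close>; thus \<open>f\<close> is the index of \<open>P\<close> in its
  centralizer.
\<close>

lemma (in group) transfer_on_subgroup:
  assumes fin: "finite (carrier G)" and P: "subgroup P G" and PC: "P \<subseteq> centralizer P"
    and fusion: "\<forall>u\<in>P - {\<one>}. \<forall>x\<in>carrier G. x \<otimes> u \<otimes> inv x \<in> P \<longrightarrow> x \<in> centralizer P"
  obtains V f where "V \<in> hom G (G\<lparr>carrier := P\<rparr>)" "f * card P = card (centralizer P)"
    "\<forall>u\<in>P. V u = u [^] (f::nat)"
proof -
  interpret P: subgroup P G by fact
  let ?C = "centralizer P"
  interpret C: subgroup ?C G using subgroup_centralizer P.subset .
  have comm: "u \<otimes> v = v \<otimes> u" if "u \<in> P" "v \<in> ?C" for u v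
    using centralizerD[OF that(2,1)] by simp
  have Pcomm: "u \<otimes> v = v \<otimes> u" if "u \<in> P" "v \<in> P" for u v using comm[OF that(1)] PC that(2) by blast
  let ?H = "G\<lparr>carrier := P\<rparr>"
  interpret PG: comm_group ?H
  proof (rule group.group_comm_groupI)
    fix x y assume "x \<in> carrier ?H" "y \<in> carrier ?H"
    then show "x \<otimes>\<^bsub>?H\<^esub> y = y \<otimes>\<^bsub>?H\<^esub> x" using Pcomm[of x y] by simp
  qed (use P.subgroup_is_group is_group in auto)
  obtain s where s: "\<forall>x\<in>carrier G. s x \<in> P"
    "\<forall>k\<in>P. \<forall>x\<in>carrier G. s (k \<otimes> x) = k \<otimes> s x"
    "\<forall>x\<in>?C. \<forall>v\<in>P. s (x \<otimes> v) = v \<otimes> s x"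
    "\<forall>x\<in>carrier G - ?C. \<forall>v\<in>P. s (x \<otimes> v) = s x"
    using equivariant_section[OF P PC fusion] by (elim exE conjE) (rule that)
  note sP = bspec[OF s(1)] and sl = s(2)[rule_format] and sC = s(3)[rule_format]
  have sN: "s (x \<otimes> v) = s x" if "x \<in> carrier G" "x \<notin> ?C" "v \<in> P" for x v
    using s(4) that by simp
  \<comment> \<open>The factor that a coset contributes to the transfer; it does not depend on the choice of \<open>y\<close>, as \<open>P\<close> is
    commutative.\<close>
  define q where "q g A = (let y = SOME y. y \<in> A in s (y \<otimes> g) \<otimes> inv s y)" for g A
  have q: "q g (P #> y) = s (y \<otimes> g) \<otimes> inv s y" if g: "g \<in> carrier G" and y: "y \<in> carrier G" for g y
  proof -
    define z where "z = (SOME z. z \<in> P #> y)"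
    have "y \<in> P #> y" using y rcos_self P by blast
    then have "z \<in> P #> y" unfolding z_def by (rule someI)
    then obtain h where h: "h \<in> P" "z = h \<otimes> y" by (auto simp: r_coset_def)
    have "q g (P #> y) = s (z \<otimes> g) \<otimes> inv s z"
      by (simp add: q_def z_def Let_def)
    also have "s (z \<otimes> g) = h \<otimes> s (y \<otimes> g)"
      using h g y sl[of h "y \<otimes> g"] by (simp add: m_assoc)
    also have "inv s z = inv h \<otimes> inv s y"
      using h y sP[OF y] sl[of h y] Pcomm[of "inv s y" "inv h"] by (simp add: inv_mult_group)
    also have "h \<otimes> s (y \<otimes> g) = s (y \<otimes> g) \<otimes> h"
      using h g y sP Pcomm[of h "s (y \<otimes> g)"] by simp
    also have "s (y \<otimes> g) \<otimes> h \<otimes> (inv h \<otimes> inv s y) = s (y \<otimes> g) \<otimes> inv s y"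
      using h(1) g y sP by (simp add: m_assoc) (simp flip: m_assoc)
    finally show ?thesis .
  qed
  have qP: "q g A \<in> P" if "g \<in> carrier G" "A \<in> rcosets P" for g A
    using that sP q by (auto simp: RCOSETS_def)
  define V where "V g = finprod ?H (q g) (rcosets P)" for g
  have act: "A #> g \<in> rcosets P" if "g \<in> carrier G" "A \<in> rcosets P" for g A
    using that P.subset by (auto simp: RCOSETS_def coset_mult_assoc)
  have act_inv: "(A #> g) #> inv g = A" "(A #> inv g) #> g = A" if "g \<in> carrier G" "A \<in> rcosets P" for g A
    using that P.subset by (auto simp: RCOSETS_def coset_mult_assoc m_assoc)
  have Vhom: "V \<in> hom G ?H"
  proof (rule homI)
    fix g assume "g \<in> carrier G" then show "V g \<in> carrier ?H"
      unfolding V_def using qP by (intro PG.finprod_closed) auto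
  next
    fix g k assume g: "g \<in> carrier G" and k: "k \<in> carrier G"
    have "q (g \<otimes> k) A = q g A \<otimes> q k (A #> g)" if A: "A \<in> rcosets P" for A
    proof -
      obtain y where y: "y \<in> carrier G" "A = P #> y" using A by (auto simp: RCOSETS_def)
      have "A #> g = P #> (y \<otimes> g)" using y g P.subset by (simp add: coset_mult_assoc)
      then have "q k (A #> g) = s (y \<otimes> g \<otimes> k) \<otimes> inv s (y \<otimes> g)" using q g k y by simp
      moreover have "q g A = inv s y \<otimes> s (y \<otimes> g)"
        using q g y sP Pcomm[of "s (y \<otimes> g)" "inv s y"] by simp
      moreover have "q (g \<otimes> k) A = inv s y \<otimes> s (y \<otimes> g \<otimes> k)"
        using q g k y sP Pcomm[of "s (y \<otimes> (g \<otimes> k))" "inv s y"] by (simp add: m_assoc)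
      moreover have "s (y \<otimes> g \<otimes> k) \<otimes> inv s (y \<otimes> g) = inv s (y \<otimes> g) \<otimes> s (y \<otimes> g \<otimes> k)"
        using g k y sP Pcomm[of "s (y \<otimes> g \<otimes> k)" "inv s (y \<otimes> g)"] by simp
      moreover have "a \<otimes> b \<otimes> (inv b \<otimes> c) = a \<otimes> c" if "a \<in> P" "b \<in> P" "c \<in> P" for a b c
        using that by (simp add: m_assoc) (simp flip: m_assoc)
      ultimately show ?thesis using g k y sP by simp
    qed
    then have "V (g \<otimes> k) = finprod ?H (\<lambda>A. q g A \<otimes>\<^bsub>?H\<^esub> q k (A #> g)) (rcosets P)"
      unfolding V_def using qP g k act by (intro PG.finprod_cong) (auto simp: simp_implies_def)
    also have "\<dots> = V g \<otimes> finprod ?H (\<lambda>A. q k (A #> g)) (rcosets P)"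
      unfolding V_def using qP g k act by (subst PG.finprod_multf) auto
    also have "finprod ?H (\<lambda>A. q k (A #> g)) (rcosets P) = V k"
    proof -
      have im: "(\<lambda>A. A #> g) ` (rcosets P) = rcosets P"
      proof
        show "rcosets P \<subseteq> (\<lambda>A. A #> g) ` (rcosets P)"
          using act[of "inv g"] act_inv(2)[OF g] g by (metis image_eqI inv_closed subsetI)
      qed (use act g in auto)
      have inj: "inj_on (\<lambda>A. A #> g) (rcosets P)" using act_inv(1)[OF g] by (rule inj_on_inverseI)
      have "finprod ?H (q k) ((\<lambda>A. A #> g) ` (rcosets P)) = finprod ?H (\<lambda>A. q k (A #> g)) (rcosets P)"
        using qP k act g inj by (intro PG.finprod_reindex) auto
      then show ?thesis unfolding im V_def by simp
    qed
    finally show "V (g \<otimes> k) = V g \<otimes>\<^bsub>?H\<^esub> V k" by simp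
  qed
  define F where "F = (\<lambda>x. P #> x) ` ?C"
  have F: "card F * card P = card ?C"
  proof -
    interpret CG: group "G\<lparr>carrier := ?C\<rparr>" using C.subgroup_is_group is_group .
    have "subgroup P (G\<lparr>carrier := ?C\<rparr>)" using subgroup_incl P C.subgroup_axioms PC by blast
    moreover have "rcosets\<^bsub>G\<lparr>carrier := ?C\<rparr>\<^esub> P = F" by (auto simp: F_def RCOSETS_def r_coset_def)
    ultimately show ?thesis using CG.lagrange[of P] by (simp add: order_def)
  qed
  have FR: "F \<subseteq> rcosets P" using C.subset by (auto simp: F_def RCOSETS_def)
  have finR: "finite (rcosets P)" using fin by (auto simp: RCOSETS_def)
  have Vu: "V u = u [^] card F" if u: "u \<in> P" for u
  proof -
    have qF: "q u A = u" if A: "A \<in> F" for A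
    proof -
      obtain y where y: "y \<in> ?C" "A = P #> y" using A by (auto simp: F_def)
      then show ?thesis using q[of u y] u sC[of y u] sP[of y] by (simp add: m_assoc)
    qed
    have qN: "q u A = \<one>" if A: "A \<in> rcosets P - F" for A
    proof -
      obtain y where y: "y \<in> carrier G" "A = P #> y" using A by (auto simp: RCOSETS_def)
      then have "y \<notin> ?C" using A by (auto simp: F_def)
      then show ?thesis using q[of u y] u y sN[of y u] sP[of y] by simp
    qed
    have "V u = finprod ?H (\<lambda>A. u) F"
      unfolding V_def using finR FR qF qN u qP by (intro PG.finprod_mono_neutral_cong_right) auto
    also have "\<dots> = u [^]\<^bsub>?H\<^esub> card F" using u by (subst PG.finprod_const) auto
    finally show ?thesis by (simp flip: nat_pow_consistent)
  qed
  then show ?thesis using that[OF Vhom F] by blast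
qed

section \<open>Minimal prime divisors and a subgroup above the derived subgroup\<close>

context group begin

lemma mult_cancel_inner:
  "x \<in> carrier G \<Longrightarrow> z \<in> carrier G \<Longrightarrow> inv x \<otimes> (x \<otimes> z) = z"
  "x \<in> carrier G \<Longrightarrow> z \<in> carrier G \<Longrightarrow> x \<otimes> (inv x \<otimes> z) = z"
  by (simp_all flip: m_assoc)

lemma conj_by_closed [simp]:
  "x \<in> carrier G \<Longrightarrow> y \<in> carrier G \<Longrightarrow> conj_by G x y \<in> carrier G"
  by (simp add: conj_by_def)

lemma conj_by_mult:
  "x \<in> carrier G \<Longrightarrow> y \<in> carrier G \<Longrightarrow> z \<in> carrier G \<Longrightarrow>
    conj_by G x (y \<otimes> z) = conj_by G x y \<otimes> conj_by G x z"
  by (simp add: conj_by_def m_assoc mult_cancel_inner)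

lemma conj_by_hom: "x \<in> carrier G \<Longrightarrow> group_hom G G (conj_by G x)"
  by unfold_locales (auto intro!: homI conj_by_mult)

lemma conj_by_conj_by:
  "x \<in> carrier G \<Longrightarrow> y \<in> carrier G \<Longrightarrow> z \<in> carrier G \<Longrightarrow>
    conj_by G x (conj_by G y z) = conj_by G (x \<otimes> y) z"
  unfolding conj_by_def by (simp add: m_assoc inv_mult_group)

lemma conj_by_one [simp]: "x \<in> carrier G \<Longrightarrow> conj_by G \<one> x = x"
  by (simp add: conj_by_def)

lemma conj_by_eq_self_iff:
  assumes "x \<in> carrier G" "y \<in> carrier G"
  shows "conj_by G x y = y \<longleftrightarrow> x \<otimes> y = y \<otimes> x"
proof
  assume "conj_by G x y = y"
  then have "x \<otimes> y \<otimes> inv x \<otimes> x = y \<otimes> x" by (simp add: conj_by_def)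
  then show "x \<otimes> y = y \<otimes> x" using assms by (simp add: m_assoc)
next
  assume "x \<otimes> y = y \<otimes> x"
  then show "conj_by G x y = y" using assms by (simp add: conj_by_def m_assoc)
qed

lemma conj_by_nat_pow_fixed_exponent:
  assumes g: "g \<in> carrier G" and u: "u \<in> carrier G" and j: "conj_by G g u = u [^] (j::nat)"
  shows "conj_by G (g [^] (k::nat)) u = u [^] (j ^ k)"
proof (induction k)
  case 0
  then show ?case using u by simp
next
  case (Suc k)
  interpret c: group_hom G G "conj_by G (g [^] k)" using g by (intro conj_by_hom) simp
  have "conj_by G (g [^] Suc k) u = conj_by G (g [^] k) (conj_by G g u)"
    using g u by (simp add: conj_by_conj_by)
  also have "\<dots> = (u [^] (j ^ k)) [^] j" using u by (simp add: j Suc.IH c.hom_nat_pow)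
  finally show ?case using u by (simp add: nat_pow_pow mult.commute)
qed

text \<open>
  The exponent \<open>j\<close> is a unit modulo \<open>p\<close> whose order divides both \<open>p - 1\<close> and the order of the group.
  These are coprime, since every prime factor of the latter is at least \<open>p\<close>.
\<close>

lemma conj_by_minimal_prime:
  assumes p: "prime p" and min: "\<And>q. prime q \<Longrightarrow> q dvd order G \<Longrightarrow> p \<le> q"
    and fin: "finite (carrier G)"
    and g: "g \<in> carrier G" and u: "u \<in> carrier G" "ord u = p"
    and pow: "conj_by G g u = u [^] (j::nat)"
  shows "g \<otimes> u = u \<otimes> g"
proof -
  define k where "k = order G"
  have k0: "k \<noteq> 0" using fin order_gt_0_iff_finite by (simp add: k_def)
  have "u [^] (j ^ k) = conj_by G (g [^] k) u"
    using conj_by_nat_pow_fixed_exponent[OF g u(1) pow] by simp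
  also have "\<dots> = u [^] (1::nat)" using g u by (simp add: k_def pow_order_eq_1)
  finally have "u [^] int (j ^ k) = u [^] int 1" by (simp only: int_pow_int)
  then have jk: "[j ^ k = 1] (mod p)"
    using int_pow_eq[OF u(1), of "int (j ^ k)" "int 1"] u(2)
    by (metis cong_iff_dvd_diff cong_int_iff cong_sym)
  have npj: "\<not> p dvd j"
  proof
    assume "p dvd j"
    then have "p dvd j ^ k" using k0 by (simp add: dvd_power_iff dvd_trans dvd_power)
    then have "p dvd 1" using jk cong_dvd_iff by blast
    then show False using p by (simp add: prime_nat_iff)
  qed
  have "coprime k (p - 1)"
  proof (rule ccontr)
    assume "\<not> coprime k (p - 1)"
    then obtain q where q: "prime q" "q dvd k" "q dvd p - 1"
      using prime_factor_nat[of "gcd k (p - 1)"] by (auto simp: coprime_iff_gcd_eq_1)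
    then have "q \<le> p - 1" using prime_gt_1_nat[OF p] by (intro dvd_imp_le) auto
    moreover have "p \<le> q" using min q k_def by blast
    ultimately show False using prime_gt_0_nat[OF p] by linarith
  qed
  then obtain a b where ab: "k * a = (p - 1) * b + 1"
    using bezout_nat[OF k0, of "p - 1"] by auto
  have "[j ^ (k * a) = 1] (mod p)" using cong_pow[OF jk, of a] by (simp add: power_mult)
  moreover have "[j ^ (k * a) = j] (mod p)"
  proof -
    have "[(j ^ (p - 1)) ^ b * j = 1 ^ b * j] (mod p)"
      using fermat_theorem[OF p npj] by (intro cong_mult cong_pow) auto
    moreover have "j ^ (k * a) = (j ^ (p - 1)) ^ b * j" by (simp only: ab power_add power_mult power_one_right)
    ultimately show ?thesis by simp
  qed
  ultimately have "[j = 1] (mod p)" using cong_sym cong_trans by blast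
  then have "u [^] int j = u [^] int 1"
    using int_pow_eq[OF u(1), of "int j" "int 1"] u(2)
    by (metis cong_iff_dvd_diff cong_int_iff cong_sym)
  then have "conj_by G g u = u" using pow u(1) by (simp only: int_pow_int) simp
  then show ?thesis using conj_by_eq_self_iff g u by simp
qed

lemma subgroup_order_dvd: "subgroup H G \<Longrightarrow> card H dvd order G"
  using lagrange[of H] by (metis dvd_triv_right)

text \<open>
  \<open>K\<close> is the kernel of the transfer to a subgroup \<open>P\<close> of order \<open>p\<close>, the smallest prime divisor of the
  order. There is no fusion in \<open>P\<close> by minimality of \<open>p\<close>. The transfer is nontrivial on \<open>P\<close> because \<open>p\<close>
  divides the order of the centralizer of \<open>P\<close> only once.
\<close>

lemma squarefree_order_proper_subgroup_above_derived:
  assumes fin: "finite (carrier G)" and sq: "squarefree (order G)" and "order G \<noteq> 1"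
  obtains K where "subgroup K G" "card K < order G" "derived G (carrier G) \<subseteq> K"
proof -
  define p where "p = (LEAST q. prime q \<and> q dvd order G)"
  have "\<exists>q. prime q \<and> q dvd order G" using assms(3) prime_factor_nat by blast
  then have p: "prime p" "p dvd order G" unfolding p_def by (metis (mono_tags, lifting) LeastI_ex)+
  have min: "p \<le> q" if "prime q" "q dvd order G" for q unfolding p_def using that by (intro Least_le) simp
  obtain x where x: "x \<in> carrier G" "ord x = p" using exists_ord_eq_prime[OF p fin] .
  define P where "P = generate G {x}"
  have P: "subgroup P G" unfolding P_def using x by (intro generate_is_subgroup) simp
  interpret P: subgroup P G by fact
  have cP: "card P = p" using generate_pow_card[OF x(1)] x(2) P_def by simp
  have gen: "ord u = p \<and> (\<forall>v\<in>P. \<exists>k::nat. v = u [^] k)" if u: "u \<in> P" "u \<noteq> \<one>" for u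
  proof -
    have uc: "u \<in> carrier G" using u by simp
    have sub: "subgroup (generate G {u}) G" using uc by (intro generate_is_subgroup) simp
    have uP: "generate G {u} \<subseteq> P" using generate_subgroup_incl[of "{u}" P] u P by simp
    interpret PG: group "G\<lparr>carrier := P\<rparr>" using P.subgroup_is_group is_group by blast
    have "card (generate G {u}) dvd order (G\<lparr>carrier := P\<rparr>)"
      using PG.lagrange[OF subgroup_incl[OF sub P uP]] by (metis dvd_triv_right)
    then have "ord u dvd p" using generate_pow_card[OF uc] cP by (simp add: order_def)
    moreover have "ord u \<noteq> 1" using u uc ord_eq_1 by auto
    ultimately have o: "ord u = p" using p(1) by (metis prime_nat_iff)
    have "finite P" using fin P.subset finite_subset by blast
    then have "generate G {u} = P" using uP o cP generate_pow_card[OF uc] card_subset_eq by metis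
    moreover have "generate G {u} = {u [^] k | k::nat. True}"
      using generate_pow_on_finite_carrier[OF fin uc] by simp
    ultimately show ?thesis using o by blast
  qed
  have pow_cent: "g \<in> centralizer P" if u: "u \<in> P" "u \<noteq> \<one>" and g: "g \<in> carrier G" and c: "g \<otimes> u = u \<otimes> g" for u g
  proof -
    interpret C: subgroup "centralizer {g}" G using g by (intro subgroup_centralizer) simp
    have "u \<in> centralizer {g}" 
      unfolding centralizer_def using P.mem_carrier[OF u(1)] c[symmetric] by blast
    then have uk: "u [^] (k::nat) \<in> centralizer {g}" for k by (induction k) auto
    show ?thesis unfolding centralizer_def mem_Collect_eq
    proof (intro conjI ballI g)
      fix v assume "v \<in> P"
      then obtain k :: nat where "v = u [^] k" using gen[OF u] by blast
      then show "g \<otimes> v = v \<otimes> g" using centralizerD[OF uk, of g k] by simp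
    qed
  qed
  have x1: "x \<noteq> \<one>" using x(2) prime_gt_1_nat[OF p(1)] by auto
  have xP: "x \<in> P" unfolding P_def by (rule generate.incl) simp
  have PC: "P \<subseteq> centralizer P"
  proof
    fix g assume g: "g \<in> P"
    then obtain k :: nat where k: "g = x [^] k" using gen[OF xP x1] by blast
    have "g \<otimes> x = x \<otimes> g" unfolding k using nat_pow_comm[OF x(1), of k 1] x(1) by simp
    then show "g \<in> centralizer P" using pow_cent[OF xP x1] g by simp
  qed
  have fusion: "\<forall>u\<in>P - {\<one>}. \<forall>g\<in>carrier G. g \<otimes> u \<otimes> inv g \<in> P \<longrightarrow> g \<in> centralizer P"
  proof (intro ballI impI)
    fix u g assume u: "u \<in> P - {\<one>}" and g: "g \<in> carrier G" and gu: "g \<otimes> u \<otimes> inv g \<in> P"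
    then have u': "u \<in> P" "u \<noteq> \<one>" by auto
    obtain j :: nat where "conj_by G g u = u [^] j" using gen[OF u'] gu unfolding conj_by_def by blast
    then have "g \<otimes> u = u \<otimes> g"
      using conj_by_minimal_prime[OF p(1) min fin g _ conjunct1[OF gen[OF u']]] u' by simp
    then show "g \<in> centralizer P" using pow_cent[OF u' g] by simp
  qed
  obtain V f where V: "V \<in> hom G (G\<lparr>carrier := P\<rparr>)" and f: "f * card P = card (centralizer P)"
    and Vu: "\<forall>u\<in>P. V u = u [^] f"
    using transfer_on_subgroup[OF fin P PC fusion] .
  interpret V: group_hom G "G\<lparr>carrier := P\<rparr>" V
    using V P.subgroup_is_group is_group by (simp add: group_hom_def group_hom_axioms_def)
  define K where "K = kernel G (G\<lparr>carrier := P\<rparr>) V"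
  have K: "subgroup K G" unfolding K_def by (rule V.subgroup_kernel)
  have "\<not> p dvd f"
  proof
    assume "p dvd f"
    then obtain m where "f = p * m" by blast
    then have "card (centralizer P) = p ^ 2 * m" using f cP by (simp add: power2_eq_square mult_ac)
    then have "p ^ 2 dvd card (centralizer P)" by simp
    then have "p ^ 2 dvd order G"
      using subgroup_order_dvd[OF subgroup_centralizer[OF P.subset]] dvd_trans by blast
    then show False using sq p(1) unfolding squarefree_def by auto
  qed
  then have "x [^] f \<noteq> \<one>" using pow_eq_id x by simp
  then have "x \<notin> K" using bspec[OF Vu xP] by (simp add: K_def kernel_def)
  moreover have Ksub: "K \<subseteq> carrier G" using K subgroup.subset by blast
  ultimately have "card K < order G" unfolding order_def using fin x by (intro psubset_card_mono) auto
  moreover have "derived G (carrier G) \<subseteq> K"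
    unfolding derived_def
  proof (rule generate_subgroup_incl[OF _ K], safe)
    fix a b assume ab: "a \<in> carrier G" "b \<in> carrier G"
    then have *: "V a \<in> P" "V b \<in> P" using V.hom_closed by auto
    then have "V a \<otimes> V b = V b \<otimes> V a" using centralizerD PC by blast
    then have ab_ba: "V (a \<otimes> b) = V (b \<otimes> a)" using ab V.hom_mult by simp
    have "a \<otimes> b \<otimes> inv a \<otimes> inv b = (a \<otimes> b) \<otimes> inv (b \<otimes> a)" using ab by (simp add: inv_mult_group m_assoc)
    then have "V (a \<otimes> b \<otimes> inv a \<otimes> inv b) = V (a \<otimes> b) \<otimes>\<^bsub>G\<lparr>carrier := P\<rparr>\<^esub> inv\<^bsub>G\<lparr>carrier := P\<rparr>\<^esub> V (b \<otimes> a)"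
      using ab by (simp only: V.hom_mult V.hom_inv m_closed inv_closed)
    also have "\<dots> = \<one>\<^bsub>G\<lparr>carrier := P\<rparr>\<^esub>" unfolding ab_ba using ab by (intro V.H.r_inv V.hom_closed) simp
    finally have "V (a \<otimes> b \<otimes> inv a \<otimes> inv b) = \<one>\<^bsub>G\<lparr>carrier := P\<rparr>\<^esub>" .
    then show "a \<otimes> b \<otimes> inv a \<otimes> inv b \<in> K" using ab by (simp add: K_def kernel_def)
  qed
  ultimately show ?thesis using that K by blast
qed

end

section \<open>The derived subgroup in squarefree order\<close>

context group begin

text \<open>
  An element of \<open>G\<close> acts on a cyclic normal subgroup by raising to a power, and power maps commute.
\<close>

lemma derived_centralizes_cyclic_normal:
  assumes N: "N \<lhd> G" and cyc: "cyclic_group (G\<lparr>carrier := N\<rparr>)"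
  shows "derived G (carrier G) \<subseteq> centralizer N"
proof -
  interpret N: normal N G by fact
  have Ns: "subgroup N G" by (rule N.subgroup_axioms)
  interpret GN: group "G\<lparr>carrier := N\<rparr>" using N.subgroup_is_group is_group by blast
  obtain c where c: "c \<in> N" "\<forall>v\<in>N. \<exists>i::int. v = c [^] i"
    using cyc int_pow_consistent[OF Ns] unfolding GN.cyclic_group by force
  have cc: "c \<in> carrier G" using c(1) by simp
  \<comment> \<open>The exponent found at a generator works for the whole subgroup.\<close>
  have exponent: "\<exists>i::int. \<forall>v\<in>N. conj_by G g v = v [^] i" if g: "g \<in> carrier G" for g
  proof -
    interpret g: group_hom G G "conj_by G g" using g by (rule conj_by_hom)
    have "conj_by G g c \<in> N" using N.inv_op_closed2[OF g c(1)] by (simp add: conj_by_def)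
    then obtain i :: int where i: "conj_by G g c = c [^] i" using c(2) by blast
    have "conj_by G g v = v [^] i" if v: "v \<in> N" for v
    proof -
      obtain k :: int where k: "v = c [^] k" using c(2) v by blast
      have "conj_by G g v = (c [^] i) [^] k" unfolding k using cc by (simp add: g.hom_int_pow i)
      then show ?thesis unfolding k using cc by (simp add: int_pow_pow mult.commute)
    qed
    then show ?thesis by blast
  qed
  have conj_comm: "conj_by G (x \<otimes> y) v = conj_by G (y \<otimes> x) v"
    if x: "x \<in> carrier G" and y: "y \<in> carrier G" and v: "v \<in> N" for x y v
  proof -
    obtain i j :: int where i: "\<forall>v\<in>N. conj_by G x v = v [^] i" and j: "\<forall>v\<in>N. conj_by G y v = v [^] j"
      using exponent x y by blast
    have vc: "v \<in> carrier G" using v by simp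
    have vi: "v [^] (i::int) \<in> N" for i using subgroup_int_pow_closed[OF Ns v] .
    have "conj_by G (x \<otimes> y) v = (v [^] j) [^] i"
      using conj_by_conj_by[OF x y vc] bspec[OF i vi[of j]] bspec[OF j v] by simp
    also have "\<dots> = (v [^] i) [^] j" using vc by (simp add: int_pow_pow mult.commute)
    also have "\<dots> = conj_by G (y \<otimes> x) v"
      using conj_by_conj_by[OF y x vc] bspec[OF j vi[of i]] bspec[OF i v] by simp
    finally show ?thesis .
  qed
  show ?thesis unfolding derived_def
  proof (rule generate_subgroup_incl[OF _ subgroup_centralizer[OF N.subset]], safe)
    fix x y assume x: "x \<in> carrier G" and y: "y \<in> carrier G"
    let ?k = "x \<otimes> y \<otimes> inv x \<otimes> inv y"
    have k: "?k \<in> carrier G" "?k = (x \<otimes> y) \<otimes> inv (y \<otimes> x)" using x y by (simp_all add: inv_mult_group m_assoc)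
    show "?k \<in> centralizer N" unfolding centralizer_def mem_Collect_eq
    proof (intro conjI ballI k(1))
      fix v assume v: "v \<in> N"
      then have vc: "v \<in> carrier G" by simp
      \<comment> \<open>Conjugation by \<open>xy\<close> and by \<open>yx\<close> agree at \<open>w\<close>; the latter takes \<open>w\<close> to \<open>v\<close>.\<close>
      define w where "w = conj_by G (inv (y \<otimes> x)) v"
      have w: "w \<in> N" unfolding w_def conj_by_def using N.inv_op_closed2[of "inv (y \<otimes> x)" v] v x y by simp
      have "conj_by G ?k v = conj_by G (x \<otimes> y) w"
        unfolding w_def k(2) using x y vc by (simp add: conj_by_conj_by)
      also have "\<dots> = conj_by G (y \<otimes> x) w" using conj_comm[OF x y w] .
      also have "\<dots> = v" unfolding w_def using x y vc by (simp add: conj_by_conj_by del: inv_mult_group)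
      finally show "?k \<otimes> v = v \<otimes> ?k" using conj_by_eq_self_iff[OF k(1) vc] by simp
    qed
  qed
qed

lemma squarefree_order_subgroup:
  "squarefree (order G) \<Longrightarrow> subgroup H G \<Longrightarrow> squarefree (order (G\<lparr>carrier := H\<rparr>))"
  using subgroup_order_dvd squarefree_mono by (simp add: order_def) blast

lemma comm_group_subgroup_iff:
  "subgroup H G \<Longrightarrow> comm_group (G\<lparr>carrier := H\<rparr>) \<longleftrightarrow> (\<forall>x\<in>H. \<forall>y\<in>H. x \<otimes> y = y \<otimes> x)"
  using subgroup.subgroup_is_group[OF _ is_group, of H]
    group.group_comm_groupI[of "G\<lparr>carrier := H\<rparr>"] comm_group.axioms(1)[of "G\<lparr>carrier := H\<rparr>"]
    comm_monoid.m_comm[of "G\<lparr>carrier := H\<rparr>"] by auto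

lemma squarefree_order_imp_abelianization_cyclic:
  assumes fin: "finite (carrier G)" and sq: "squarefree (order G)" 
  shows "cyclic_group (G Mod derived G (carrier G))"
proof -
  interpret D: normal "derived G (carrier G)" G by (rule derived_self_is_normal)
  interpret Q: comm_group "G Mod derived G (carrier G)" by (rule derived_quot_is_comm_group)
  have o: "order (G Mod derived G (carrier G)) * card (derived G (carrier G)) = order G"
    using lagrange[OF D.subgroup_axioms] by (simp add: order_def FactGroup_def)
  have "squarefree (order (G Mod derived G (carrier G)))" using sq o by (metis dvd_triv_left squarefree_mono)
  moreover have "finite (carrier (G Mod derived G (carrier G)))"
    using o fin order_gt_0_iff_finite Q.order_gt_0_iff_finite by (metis mult_is_0 neq0_conv)
  ultimately show ?thesis by (intro Q.squarefree_order_imp_cyclic)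
qed

text \<open>
  The second derived subgroup is cyclic, hence centralized by the derived subgroup \<open>N\<close>. So \<open>N\<close> is a
  central extension of its abelianization, which is cyclic as well.
\<close>

lemma derived_comm_if_second_derived_comm:
  assumes fin: "finite (carrier G)" and sq: "squarefree (order G)"
    and D2: "comm_group (G\<lparr>carrier := derived G (derived G (carrier G))\<rparr>)"
  shows "comm_group (G\<lparr>carrier := derived G (carrier G)\<rparr>)"
proof -
  let ?D1 = "derived G (carrier G)" let ?D2 = "derived G ?D1" let ?N = "G\<lparr>carrier := ?D1\<rparr>"
  have n2: "?D2 \<lhd> G" by (intro derived_is_normal normal_self)
  interpret D2: normal ?D2 G by (rule n2)
  have s1: "subgroup ?D1 G" by (intro derived_is_subgroup) simp
  interpret C2: comm_group "G\<lparr>carrier := ?D2\<rparr>" by (rule D2)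
  have f: "finite H" if "subgroup H G" for H using that fin subgroup.subset finite_subset by blast
  have "cyclic_group (G\<lparr>carrier := ?D2\<rparr>)"
    using squarefree_order_subgroup[OF sq D2.subgroup_axioms] f[OF D2.subgroup_axioms]
    by (intro C2.squarefree_order_imp_cyclic) auto
  then have cen: "?D1 \<subseteq> centralizer ?D2" using derived_centralizes_cyclic_normal[OF n2] by simp
  interpret N: group ?N using s1 subgroup.subgroup_is_group is_group by blast
  have dN: "derived ?N (carrier ?N) = ?D2" using derived_consistent[OF _ s1, of ?D1] by simp
  interpret DN: normal ?D2 ?N using N.derived_self_is_normal unfolding dN .
  interpret Q: group "?N Mod ?D2" by (rule DN.factorgroup_is_group)
  interpret h: group_hom ?N "?N Mod ?D2" "\<lambda>a. ?D2 #>\<^bsub>?N\<^esub> a"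
    by unfold_locales (rule DN.r_coset_hom_Mod)
  show ?thesis
  proof (rule h.cyclic_image_central_kernel_imp_comm)
    show "cyclic_group (?N Mod ?D2)"
      using N.squarefree_order_imp_abelianization_cyclic squarefree_order_subgroup[OF sq s1] f[OF s1] unfolding dN by simp
    show "(\<lambda>a. ?D2 #>\<^bsub>?N\<^esub> a) ` carrier ?N = carrier (?N Mod ?D2)"
      by (auto simp: FactGroup_def RCOSETS_def)
  next
    fix z y assume z: "z \<in> kernel ?N (?N Mod ?D2) (\<lambda>a. ?D2 #>\<^bsub>?N\<^esub> a)" and y: "y \<in> carrier ?N"
    have "z \<in> ?D2" using z N.coset_join1[OF _ _ DN.subgroup_axioms] by (auto simp: kernel_def FactGroup_def)
    then have "y \<otimes> z = z \<otimes> y" using y cen centralizerD by fastforce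
    then show "z \<otimes>\<^bsub>?N\<^esub> y = y \<otimes>\<^bsub>?N\<^esub> z" by simp
  qed
qed

end

text \<open>
  The induction hypothesis is applied to a proper subgroup \<open>K\<close> that contains the derived subgroup: the
  second derived subgroup of \<open>G\<close> lies in the derived subgroup of \<open>K\<close>.
\<close>

theorem squarefree_order_imp_derived_comm:
  fixes G :: "('a, 'b) monoid_scheme"
  assumes "group G" "finite (carrier G)" "squarefree (order G)"
  shows "comm_group (G\<lparr>carrier := derived G (carrier G)\<rparr>)"
  using assms
proof (induction "order G" arbitrary: G rule: less_induct)
  case less
  interpret group G by fact
  note fin = less.prems(2) and sq = less.prems(3)
  have D2: "subgroup (derived G (derived G (carrier G))) G"
    by (intro derived_is_subgroup derived_in_carrier) simp
  have "comm_group (G\<lparr>carrier := derived G (derived G (carrier G))\<rparr>)"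
  proof (cases "order G = 1")
    case True
    then have "carrier G = {\<one>\<^bsub>G\<^esub>}" using one_closed unfolding order_def by (metis card_1_singletonE singletonD)
    then show ?thesis using comm_group_subgroup_iff[OF D2] subgroup.subset[OF D2] by auto
  next
    case False
    obtain K where K: "subgroup K G" "card K < order G" "derived G (carrier G) \<subseteq> K"
      using squarefree_order_proper_subgroup_above_derived[OF fin sq False] .
    interpret KG: group "G\<lparr>carrier := K\<rparr>" using K(1) subgroup.subgroup_is_group is_group by blast
    have fK: "finite K" using K(1) fin subgroup.subset finite_subset by blast
    have dK: "derived (G\<lparr>carrier := K\<rparr>) (carrier (G\<lparr>carrier := K\<rparr>)) = derived G K"
      using derived_consistent[OF _ K(1), of K] by simp
    have "comm_group (G\<lparr>carrier := derived G K\<rparr>)"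
      using less.hyps[of "G\<lparr>carrier := K\<rparr>"] K(2) fK squarefree_order_subgroup[OF sq K(1)] KG.is_group dK
      by (simp add: order_def)
    moreover have "subgroup (derived G K) G" using K(1) subgroup.subset by (intro derived_is_subgroup) blast
    moreover have "derived G (derived G (carrier G)) \<subseteq> derived G K" using K(3) by (rule mono_derived)
    ultimately show ?thesis using comm_group_subgroup_iff D2 by blast
  qed
  then show ?case using derived_comm_if_second_derived_comm[OF fin sq] by blast
qed

section \<open>Commutator pairings\<close>

abbreviation commutator :: "('a, 'b) monoid_scheme \<Rightarrow> 'a \<Rightarrow> 'a \<Rightarrow> 'a" where
  "commutator G x y \<equiv> x \<otimes>\<^bsub>G\<^esub> y \<otimes>\<^bsub>G\<^esub> inv\<^bsub>G\<^esub> x \<otimes>\<^bsub>G\<^esub> inv\<^bsub>G\<^esub> y"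

context group begin

lemma conj_by_conj_by_same:
  "x \<in> carrier G \<Longrightarrow> y \<in> carrier G \<Longrightarrow> z \<in> carrier G \<Longrightarrow>
    conj_by G (conj_by G x y) (conj_by G x z) = conj_by G (x \<otimes> y) z"
  by (simp add: conj_by_def m_assoc mult_cancel_inner inv_mult_group)

lemma commutator_in_derived:
  "x \<in> carrier G \<Longrightarrow> y \<in> carrier G \<Longrightarrow> commutator G x y \<in> derived G (carrier G)"
  unfolding derived_def by (rule generate.incl) blast

lemma derived_subset_subgroup:
  assumes "subgroup S G" "\<And>x y. x \<in> carrier G \<Longrightarrow> y \<in> carrier G \<Longrightarrow> commutator G x y \<in> S"
  shows "derived G (carrier G) \<subseteq> S"
  unfolding derived_def using assms by (intro generate_subgroup_incl) auto

end

text \<open>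
  The tensor square, described by what the bound on its order needs: the defining relations of the
  symbols \<open>\<tau> g h\<close>, generation by the symbols, and the commutator map \<open>\<kappa>\<close>. Keeping \<open>T\<close> abstract hides
  the words that represent its elements.
\<close>

locale commutator_pairing = G: group G + T: group T
  for G :: "('a, 'b) monoid_scheme" (structure) and T :: "('c, 'd) monoid_scheme" +
  fixes \<tau> :: "'a \<Rightarrow> 'a \<Rightarrow> 'c" and \<kappa> :: "'c \<Rightarrow> 'a"
  assumes pair_closed [simp]: "\<lbrakk>g \<in> carrier G; h \<in> carrier G\<rbrakk> \<Longrightarrow> \<tau> g h \<in> carrier T"
    and pair_mult_left: "\<lbrakk>g' \<in> carrier G; g \<in> carrier G; h \<in> carrier G\<rbrakk> \<Longrightarrow>
      \<tau> (g' \<otimes> g) h = \<tau> (conj_by G g' g) (conj_by G g' h) \<otimes>\<^bsub>T\<^esub> \<tau> g' h"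
    and pair_mult_right: "\<lbrakk>g \<in> carrier G; h' \<in> carrier G; h \<in> carrier G\<rbrakk> \<Longrightarrow>
      \<tau> g (h' \<otimes> h) = \<tau> g h' \<otimes>\<^bsub>T\<^esub> \<tau> (conj_by G h' g) (conj_by G h' h)"
    and generated_by_pairs: "\<lbrakk>subgroup S T;
      \<And>g h. g \<in> carrier G \<Longrightarrow> h \<in> carrier G \<Longrightarrow> \<tau> g h \<in> S\<rbrakk> \<Longrightarrow> carrier T \<subseteq> S"
    and kappa_hom: "\<kappa> \<in> hom T G"
    and kappa_pair: "\<lbrakk>g \<in> carrier G; h \<in> carrier G\<rbrakk> \<Longrightarrow> \<kappa> (\<tau> g h) = commutator G g h"
begin

sublocale \<kappa>: group_hom T G \<kappa>
  by unfold_locales (rule kappa_hom)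

abbreviation G' where "G' \<equiv> derived G (carrier G)"

lemma subgroup_derived: "subgroup G' G"
  by (intro G.derived_is_subgroup) simp

sublocale G': normal G' G
  by (rule G.derived_self_is_normal)

lemma pair_one [simp]:
  assumes "g \<in> carrier G" shows "\<tau> \<one> g = \<one>\<^bsub>T\<^esub>" "\<tau> g \<one> = \<one>\<^bsub>T\<^esub>"
proof -
  show "\<tau> \<one> g = \<one>\<^bsub>T\<^esub>"
    using pair_mult_left[of \<one> \<one> g] assms T.r_cancel_one'[of "\<tau> \<one> g" "\<tau> \<one> g"] by simp
  show "\<tau> g \<one> = \<one>\<^bsub>T\<^esub>"
    using pair_mult_right[of g \<one> \<one>] assms T.r_cancel_one'[of "\<tau> g \<one>" "\<tau> g \<one>"] by simp
qed

text \<open>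
  The two ways to expand \<open>\<tau> (g x') (h y')\<close> by the relations have the same outer factors; the inner ones
  differ by the order of \<open>\<tau> g h\<close> and a conjugate of \<open>\<tau> x' y'\<close>.
\<close>

lemma pair_conj_pair:
  assumes g: "g \<in> carrier G" and h: "h \<in> carrier G" and x: "x \<in> carrier G" and y: "y \<in> carrier G"
  shows "\<tau> g h \<otimes>\<^bsub>T\<^esub> \<tau> x y =
    \<tau> (conj_by G (commutator G g h) x) (conj_by G (commutator G g h) y) \<otimes>\<^bsub>T\<^esub> \<tau> g h"
proof -
  \<comment> \<open>The comparison yields a relation between \<open>\<tau>\<close> conjugated by \<open>gh\<close> and by \<open>hg\<close>; this substitution
removes the second conjugation.\<close>
  define x' y' where "x' = conj_by G (inv (h \<otimes> g)) x" and "y' = conj_by G (inv (h \<otimes> g)) y"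
  have c: "x' \<in> carrier G" "y' \<in> carrier G" unfolding x'_def y'_def using assms by simp_all
  let ?L = "\<tau> (conj_by G g x') (conj_by G g h)" and ?R = "\<tau> (conj_by G h g) (conj_by G h y')"
  have "\<tau> (g \<otimes> x') (h \<otimes> y') = ?L \<otimes>\<^bsub>T\<^esub> \<tau> (conj_by G (g \<otimes> h) x') (conj_by G (g \<otimes> h) y') \<otimes>\<^bsub>T\<^esub> (\<tau> g h \<otimes>\<^bsub>T\<^esub> ?R)"
    unfolding pair_mult_left[OF g c(1) G.m_closed[OF h c(2)]]
    using g h c by (simp add: pair_mult_right G.conj_by_mult G.conj_by_conj_by_same)
  moreover have "\<tau> (g \<otimes> x') (h \<otimes> y') = ?L \<otimes>\<^bsub>T\<^esub> \<tau> g h \<otimes>\<^bsub>T\<^esub> (\<tau> (conj_by G (h \<otimes> g) x') (conj_by G (h \<otimes> g) y') \<otimes>\<^bsub>T\<^esub> ?R)"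
    unfolding pair_mult_right[OF G.m_closed[OF g c(1)] h c(2)]
    using g h c by (simp add: pair_mult_left G.conj_by_mult G.conj_by_conj_by_same)
  ultimately have "\<tau> (conj_by G (g \<otimes> h) x') (conj_by G (g \<otimes> h) y') \<otimes>\<^bsub>T\<^esub> \<tau> g h =
      \<tau> g h \<otimes>\<^bsub>T\<^esub> \<tau> (conj_by G (h \<otimes> g) x') (conj_by G (h \<otimes> g) y')"
    using g h c by (simp add: T.m_assoc) (simp flip: T.m_assoc)
  moreover have "conj_by G (h \<otimes> g) x' = x" "conj_by G (h \<otimes> g) y' = y"
    unfolding x'_def y'_def using assms by (simp_all add: G.conj_by_conj_by del: G.inv_mult_group)
  moreover have "(g \<otimes> h) \<otimes> inv (h \<otimes> g) = commutator G g h"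
    using g h by (simp add: G.inv_mult_group G.m_assoc)
  then have "conj_by G (g \<otimes> h) x' = conj_by G (commutator G g h) x"
    "conj_by G (g \<otimes> h) y' = conj_by G (commutator G g h) y"
    unfolding x'_def y'_def using assms by (simp_all add: G.conj_by_conj_by del: G.inv_mult_group)
  ultimately show ?thesis by simp
qed

text \<open>
  The elements \<open>t\<close> with this property form a subgroup, and \<open>pair_conj_pair\<close> covers the generators.
\<close>

lemma mult_pair:
  assumes t: "t \<in> carrier T" and x: "x \<in> carrier G" and y: "y \<in> carrier G"
  shows "t \<otimes>\<^bsub>T\<^esub> \<tau> x y = \<tau> (conj_by G (\<kappa> t) x) (conj_by G (\<kappa> t) y) \<otimes>\<^bsub>T\<^esub> t"
proof -
  define S where "S = {t \<in> carrier T. \<forall>x\<in>carrier G. \<forall>y\<in>carrier G.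
    t \<otimes>\<^bsub>T\<^esub> \<tau> x y = \<tau> (conj_by G (\<kappa> t) x) (conj_by G (\<kappa> t) y) \<otimes>\<^bsub>T\<^esub> t}"
  have "subgroup S T"
  proof (rule T.subgroupI)
    have "\<one>\<^bsub>T\<^esub> \<in> S" by (simp add: S_def)
    then show "S \<noteq> {}" by blast
  next
    fix t assume t: "t \<in> S"
    then have tc: "t \<in> carrier T" by (simp add: S_def)
    have "inv\<^bsub>T\<^esub> t \<otimes>\<^bsub>T\<^esub> \<tau> x y = \<tau> (conj_by G (inv (\<kappa> t)) x) (conj_by G (inv (\<kappa> t)) y) \<otimes>\<^bsub>T\<^esub> inv\<^bsub>T\<^esub> t"
      if x: "x \<in> carrier G" and y: "y \<in> carrier G" for x y
    proof -
      define x' y' where "x' = conj_by G (inv (\<kappa> t)) x" and "y' = conj_by G (inv (\<kappa> t)) y"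
      have c: "x' \<in> carrier G" "y' \<in> carrier G" unfolding x'_def y'_def using x y tc by simp_all
      have xy: "conj_by G (\<kappa> t) x' = x" "conj_by G (\<kappa> t) y' = y"
        unfolding x'_def y'_def using x y tc by (simp_all add: G.conj_by_conj_by)
      have "t \<otimes>\<^bsub>T\<^esub> \<tau> x' y' = \<tau> x y \<otimes>\<^bsub>T\<^esub> t" using t c xy unfolding S_def by force
      then have "inv\<^bsub>T\<^esub> t \<otimes>\<^bsub>T\<^esub> (t \<otimes>\<^bsub>T\<^esub> \<tau> x' y') \<otimes>\<^bsub>T\<^esub> inv\<^bsub>T\<^esub> t = inv\<^bsub>T\<^esub> t \<otimes>\<^bsub>T\<^esub> (\<tau> x y \<otimes>\<^bsub>T\<^esub> t) \<otimes>\<^bsub>T\<^esub> inv\<^bsub>T\<^esub> t"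
        by (rule arg_cong)
      then have "\<tau> x' y' \<otimes>\<^bsub>T\<^esub> inv\<^bsub>T\<^esub> t = inv\<^bsub>T\<^esub> t \<otimes>\<^bsub>T\<^esub> \<tau> x y"
        using tc c x y by (simp add: T.m_assoc T.mult_cancel_inner)
      then show ?thesis unfolding x'_def y'_def by simp
    qed
    then show "inv\<^bsub>T\<^esub> t \<in> S" using tc unfolding S_def by simp
  next
    fix s t assume st: "s \<in> S" "t \<in> S"
    then have c: "s \<in> carrier T" "t \<in> carrier T" by (simp_all add: S_def)
    have "s \<otimes>\<^bsub>T\<^esub> t \<otimes>\<^bsub>T\<^esub> \<tau> x y = \<tau> (conj_by G (\<kappa> s \<otimes> \<kappa> t) x) (conj_by G (\<kappa> s \<otimes> \<kappa> t) y) \<otimes>\<^bsub>T\<^esub> (s \<otimes>\<^bsub>T\<^esub> t)"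
      if x: "x \<in> carrier G" and y: "y \<in> carrier G" for x y
    proof -
      have 1: "t \<otimes>\<^bsub>T\<^esub> \<tau> x y = \<tau> (conj_by G (\<kappa> t) x) (conj_by G (\<kappa> t) y) \<otimes>\<^bsub>T\<^esub> t"
        using st(2) x y unfolding S_def by blast
      have 2: "s \<otimes>\<^bsub>T\<^esub> \<tau> u v = \<tau> (conj_by G (\<kappa> s) u) (conj_by G (\<kappa> s) v) \<otimes>\<^bsub>T\<^esub> s"
        if "u \<in> carrier G" "v \<in> carrier G" for u v
        using st(1) that unfolding S_def by blast
      let ?u = "conj_by G (\<kappa> t) x" and ?v = "conj_by G (\<kappa> t) y"
      have uv: "?u \<in> carrier G" "?v \<in> carrier G" using c x y by simp_all
      have "s \<otimes>\<^bsub>T\<^esub> t \<otimes>\<^bsub>T\<^esub> \<tau> x y = s \<otimes>\<^bsub>T\<^esub> \<tau> ?u ?v \<otimes>\<^bsub>T\<^esub> t"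
        using c x y uv 1 by (simp add: T.m_assoc)
      also have "\<dots> = \<tau> (conj_by G (\<kappa> s) ?u) (conj_by G (\<kappa> s) ?v) \<otimes>\<^bsub>T\<^esub> (s \<otimes>\<^bsub>T\<^esub> t)"
        unfolding 2[OF uv] using c uv by (simp add: T.m_assoc)
      finally show ?thesis using c x y by (simp add: G.conj_by_conj_by)
    qed
    then show "s \<otimes>\<^bsub>T\<^esub> t \<in> S" using c unfolding S_def by simp
  qed (auto simp: S_def)
  moreover have "\<tau> g h \<in> S" if "g \<in> carrier G" "h \<in> carrier G" for g h
    unfolding S_def mem_Collect_eq kappa_pair[OF that]
    using that by (intro conjI ballI pair_conj_pair pair_closed)
  ultimately have "carrier T \<subseteq> S" by (rule generated_by_pairs)
  then show ?thesis using t x y unfolding S_def by blast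
qed

lemma kernel_kappa_central:
  assumes z: "z \<in> kernel T G \<kappa>" and t: "t \<in> carrier T"
  shows "z \<otimes>\<^bsub>T\<^esub> t = t \<otimes>\<^bsub>T\<^esub> z"
proof -
  have zc: "z \<in> carrier T" "\<kappa> z = \<one>" using z by (simp_all add: kernel_def)
  have "carrier T \<subseteq> T.centralizer {z}"
  proof (rule generated_by_pairs)
    show "subgroup (T.centralizer {z}) T" using zc by (intro T.subgroup_centralizer) simp
    fix g h assume gh: "g \<in> carrier G" "h \<in> carrier G"
    then show "\<tau> g h \<in> T.centralizer {z}"
      using mult_pair[OF zc(1) gh] zc unfolding T.centralizer_def by simp
  qed
  then show ?thesis using T.centralizerD[of t "{z}" z] t by auto
qed

lemma kappa_image: "\<kappa> ` carrier T = G'"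
proof
  have "subgroup {t \<in> carrier T. \<kappa> t \<in> G'} T"
  proof (rule T.subgroupI)
    have "\<one>\<^bsub>T\<^esub> \<in> {t \<in> carrier T. \<kappa> t \<in> G'}" by simp
    then show "{t \<in> carrier T. \<kappa> t \<in> G'} \<noteq> {}" by blast
  qed auto
  then have "carrier T \<subseteq> {t \<in> carrier T. \<kappa> t \<in> G'}"
    by (rule generated_by_pairs) (simp add: kappa_pair G.commutator_in_derived)
  then show "\<kappa> ` carrier T \<subseteq> G'" by blast
  show "G' \<subseteq> \<kappa> ` carrier T"
    by (rule G.derived_subset_subgroup[OF \<kappa>.img_is_subgroup]) (metis image_eqI kappa_pair pair_closed)
qed

lemma kappa_hom_derived: "group_hom T (G\<lparr>carrier := G'\<rparr>) \<kappa>"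
  using G'.subgroup_is_group[OF G.is_group] kappa_hom kappa_image
  by (auto simp: group_hom_def group_hom_axioms_def hom_def)

text \<open>
  \<open>T\<close> is a central extension of the derived subgroup by the kernel of \<open>\<kappa>\<close>.
\<close>

lemma comm_group_if_derived_cyclic:
  assumes "cyclic_group (G\<lparr>carrier := G'\<rparr>)"
  shows "comm_group T"
proof -
  interpret k: group_hom T "G\<lparr>carrier := G'\<rparr>" \<kappa> by (rule kappa_hom_derived)
  show ?thesis
    using kernel_kappa_central
    by (intro k.cyclic_image_central_kernel_imp_comm[OF assms]) (auto simp: kappa_image kernel_def)
qed

end

section \<open>Commutator pairings with abelian target\<close>

locale abelian_commutator_pairing = commutator_pairing G T \<tau> \<kappa>
  for G :: "('a, 'b) monoid_scheme" (structure) and T :: "('c, 'd) monoid_scheme" and \<tau> \<kappa> +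
  assumes comm: "comm_group T"
begin

sublocale T: comm_group T
  by (rule comm)

text \<open>
  Conjugation by an element of \<open>T\<close> is trivial, and it acts on symbols through its image under \<open>\<kappa>\<close>.
\<close>

lemma pair_conj_derived:
  assumes c: "c \<in> G'" and x: "x \<in> carrier G" and y: "y \<in> carrier G"
  shows "\<tau> (conj_by G c x) (conj_by G c y) = \<tau> x y"
proof -
  have "c \<in> \<kappa> ` carrier T" unfolding kappa_image by (rule c)
  then obtain t where t: "t \<in> carrier T" "\<kappa> t = c" by (metis imageE)
  have "t \<otimes>\<^bsub>T\<^esub> \<tau> x y = \<tau> (conj_by G c x) (conj_by G c y) \<otimes>\<^bsub>T\<^esub> t"
    using mult_pair[OF t(1) x y] unfolding t(2) .
  moreover have "t \<otimes>\<^bsub>T\<^esub> \<tau> x y = \<tau> x y \<otimes>\<^bsub>T\<^esub> t" using t(1) x y by (intro T.m_comm) simp_all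
  ultimately have "\<tau> (conj_by G c x) (conj_by G c y) \<otimes>\<^bsub>T\<^esub> t = \<tau> x y \<otimes>\<^bsub>T\<^esub> t" by (simp only:)
  then show ?thesis using t(1) c x y by simp
qed

lemma pair_derived_mult:
  assumes "c \<in> G'" "x \<in> carrier G" "y \<in> carrier G"
  shows "\<tau> (c \<otimes> x) y = \<tau> x y \<otimes>\<^bsub>T\<^esub> \<tau> c y" "\<tau> y (c \<otimes> x) = \<tau> y c \<otimes>\<^bsub>T\<^esub> \<tau> y x"
  using assms pair_conj_derived[of c x y] pair_conj_derived[of c y x]
  by (simp_all add: pair_mult_left pair_mult_right)

lemma pair_derived_inv:
  assumes c: "c \<in> G'" and x: "x \<in> carrier G"
  shows "\<tau> (inv c) x = inv\<^bsub>T\<^esub> \<tau> c x" "\<tau> x (inv c) = inv\<^bsub>T\<^esub> \<tau> x c"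
proof -
  have "\<tau> (inv c) x \<otimes>\<^bsub>T\<^esub> \<tau> c x = \<one>\<^bsub>T\<^esub>" using pair_derived_mult(1)[OF c, of "inv c" x] c x by simp
  then show "\<tau> (inv c) x = inv\<^bsub>T\<^esub> \<tau> c x" using c x by (intro T.inv_equality[symmetric]) simp_all
  have "\<tau> x (inv c) \<otimes>\<^bsub>T\<^esub> \<tau> x c = \<one>\<^bsub>T\<^esub>"
    using pair_derived_mult(2)[OF c, of "inv c" x] c x T.m_comm[of "\<tau> x c" "\<tau> x (inv c)"] by simp
  then show "\<tau> x (inv c) = inv\<^bsub>T\<^esub> \<tau> x c" using c x by (intro T.inv_equality[symmetric]) simp_all
qed

text \<open>
  This and the next lemma express the conjugate of a symbol by \<open>x\<close> through symbols in which one entry is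
  a commutator. Here \<open>\<tau> g (h z) = \<tau> g (x h)\<close> is expanded on both sides, where \<open>z\<close> is the conjugate of
  \<open>x\<close> for which \<open>h z = x h\<close>.
\<close>

lemma pair_commutator_left:
  assumes g: "g \<in> carrier G" and h: "h \<in> carrier G" and x: "x \<in> carrier G"
  shows "\<tau> g h \<otimes>\<^bsub>T\<^esub> \<tau> (commutator G h g) x = \<tau> (conj_by G x g) (conj_by G x h)"
proof -
  define k where "k = commutator G h g"
  have k: "k \<in> G'" "conj_by G h g = k \<otimes> g" "k \<in> carrier G"
    unfolding k_def using G.commutator_in_derived[OF h g] g h by (simp_all add: conj_by_def G.m_assoc)
  define z where "z = inv h \<otimes> x \<otimes> h"
  have z: "z \<in> carrier G" "conj_by G h z = x" "h \<otimes> z = x \<otimes> h"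
    unfolding z_def using h x by (simp_all add: conj_by_def G.m_assoc G.mult_cancel_inner)
  have "\<tau> g (h \<otimes> z) = \<tau> g h \<otimes>\<^bsub>T\<^esub> (\<tau> g x \<otimes>\<^bsub>T\<^esub> \<tau> k x)"
    unfolding pair_mult_right[OF g h z(1)] z(2) k(2) pair_derived_mult(1)[OF k(1) g x] ..
  moreover have "\<tau> g (x \<otimes> h) = \<tau> g x \<otimes>\<^bsub>T\<^esub> \<tau> (conj_by G x g) (conj_by G x h)"
    by (rule pair_mult_right[OF g x h])
  ultimately have "\<tau> g x \<otimes>\<^bsub>T\<^esub> (\<tau> g h \<otimes>\<^bsub>T\<^esub> \<tau> k x) = \<tau> g x \<otimes>\<^bsub>T\<^esub> \<tau> (conj_by G x g) (conj_by G x h)"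
    using z(3) g h x k by (simp add: T.m_lcomm)
  then show ?thesis using g h x k unfolding k_def[symmetric] by simp
qed

lemma pair_commutator_right:
  assumes g: "g \<in> carrier G" and h: "h \<in> carrier G" and x: "x \<in> carrier G"
  shows "\<tau> g h \<otimes>\<^bsub>T\<^esub> \<tau> x (commutator G g h) = \<tau> (conj_by G x g) (conj_by G x h)"
proof -
  define k where "k = commutator G g h"
  have k: "k \<in> G'" "conj_by G g h = k \<otimes> h" "k \<in> carrier G"
    unfolding k_def using G.commutator_in_derived[OF g h] g h by (simp_all add: conj_by_def G.m_assoc)
  define z where "z = inv g \<otimes> x \<otimes> g"
  have z: "z \<in> carrier G" "conj_by G g z = x" "g \<otimes> z = x \<otimes> g"
    unfolding z_def using g x by (simp_all add: conj_by_def G.m_assoc G.mult_cancel_inner)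
  have "\<tau> (g \<otimes> z) h = \<tau> x k \<otimes>\<^bsub>T\<^esub> \<tau> x h \<otimes>\<^bsub>T\<^esub> \<tau> g h"
    unfolding pair_mult_left[OF g z(1) h] z(2) k(2) pair_derived_mult(2)[OF k(1) h x] ..
  moreover have "\<tau> (x \<otimes> g) h = \<tau> (conj_by G x g) (conj_by G x h) \<otimes>\<^bsub>T\<^esub> \<tau> x h"
    by (rule pair_mult_left[OF x g h])
  ultimately have "(\<tau> g h \<otimes>\<^bsub>T\<^esub> \<tau> x k) \<otimes>\<^bsub>T\<^esub> \<tau> x h = \<tau> (conj_by G x g) (conj_by G x h) \<otimes>\<^bsub>T\<^esub> \<tau> x h"
    using z(3) g h x k by (simp add: T.m_ac)
  then show ?thesis using g h x k unfolding k_def[symmetric] by simp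
qed

text \<open>
  For \<open>x\<close> in the derived subgroup, the conjugate in \<open>pair_commutator_left\<close> equals \<open>\<tau> g h\<close> itself, so the
  symbol with the commutator entry is trivial. Commutators generate the derived subgroup.
\<close>

lemma pair_derived_derived:
  assumes "c \<in> G'" "d \<in> G'"
  shows "\<tau> c d = \<one>\<^bsub>T\<^esub>"
proof -
  define S where "S = {c \<in> G'. \<forall>d\<in>G'. \<tau> c d = \<one>\<^bsub>T\<^esub>}"
  have "subgroup S G"
  proof (rule G.subgroupI)
    have "\<one> \<in> S" by (simp add: S_def)
    then show "S \<noteq> {}" by blast
  qed (auto simp: S_def pair_derived_mult pair_derived_inv)
  moreover have "commutator G h g \<in> S" if gh: "h \<in> carrier G" "g \<in> carrier G" for h g
  proof -
    have "\<tau> (commutator G h g) d = \<one>\<^bsub>T\<^esub>" if d: "d \<in> G'" for d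
      using pair_commutator_left[of g h d] pair_conj_derived[OF d gh(2,1)] gh d
        T.r_cancel_one[of "\<tau> g h" "\<tau> (commutator G h g) d"] by simp
    then show ?thesis unfolding S_def using G.commutator_in_derived[OF gh] by blast
  qed
  ultimately have "G' \<subseteq> S" by (rule G.derived_subset_subgroup)
  then show ?thesis using assms unfolding S_def by blast
qed

text \<open>
  Both \<open>pair_commutator_left\<close> and \<open>pair_commutator_right\<close> compute the conjugate of \<open>\<tau> g h\<close> by \<open>x\<close>. For
  \<open>k = [h,g]\<close> the comparison gives \<open>\<tau> k x = \<tau> x (inv k)\<close>.
\<close>

lemma pair_derived_anticommute:
  assumes "c \<in> G'" "x \<in> carrier G"
  shows "\<tau> c x \<otimes>\<^bsub>T\<^esub> \<tau> x c = \<one>\<^bsub>T\<^esub>"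
proof -
  define S where "S = {c \<in> G'. \<forall>x\<in>carrier G. \<tau> c x \<otimes>\<^bsub>T\<^esub> \<tau> x c = \<one>\<^bsub>T\<^esub>}"
  have "subgroup S G"
  proof (rule G.subgroupI)
    have "\<one> \<in> S" by (simp add: S_def)
    then show "S \<noteq> {}" by blast
  next
    fix c assume c: "c \<in> S"
    have "\<tau> (inv c) x \<otimes>\<^bsub>T\<^esub> \<tau> x (inv c) = inv\<^bsub>T\<^esub> (\<tau> c x \<otimes>\<^bsub>T\<^esub> \<tau> x c)" if "x \<in> carrier G" for x
      using c that by (subst T.inv_mult) (simp_all add: S_def pair_derived_inv)
    then show "inv c \<in> S" using c by (simp add: S_def)
  next
    fix c d assume cd: "c \<in> S" "d \<in> S"
    have "\<tau> (c \<otimes> d) x \<otimes>\<^bsub>T\<^esub> \<tau> x (c \<otimes> d) = (\<tau> c x \<otimes>\<^bsub>T\<^esub> \<tau> x c) \<otimes>\<^bsub>T\<^esub> (\<tau> d x \<otimes>\<^bsub>T\<^esub> \<tau> x d)" if "x \<in> carrier G" for x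
      using cd that by (simp add: S_def pair_derived_mult T.m_ac)
    then show "c \<otimes> d \<in> S" using cd by (simp add: S_def)
  qed (auto simp: S_def)
  moreover have "commutator G h g \<in> S" if gh: "h \<in> carrier G" "g \<in> carrier G" for h g
  proof -
    define k where "k = commutator G h g"
    have k: "k \<in> G'" unfolding k_def using G.commutator_in_derived[OF gh] .
    have ik: "commutator G g h = inv k" unfolding k_def using gh by (simp add: G.inv_mult_group G.m_assoc)
    have "\<tau> k x \<otimes>\<^bsub>T\<^esub> \<tau> x k = \<one>\<^bsub>T\<^esub>" if x: "x \<in> carrier G" for x
    proof -
      have "\<tau> g h \<otimes>\<^bsub>T\<^esub> \<tau> k x = \<tau> g h \<otimes>\<^bsub>T\<^esub> \<tau> x (inv k)"
        using pair_commutator_left[OF gh(2,1) x] pair_commutator_right[OF gh(2,1) x] unfolding k_def[symmetric] ik by simp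
      then have "\<tau> k x = inv\<^bsub>T\<^esub> \<tau> x k" using gh x k by (simp add: pair_derived_inv)
      then show ?thesis using k x by simp
    qed
    then show ?thesis unfolding S_def using k unfolding k_def by blast
  qed
  ultimately have "G' \<subseteq> S" by (rule G.derived_subset_subgroup)
  then show ?thesis using assms unfolding S_def by blast
qed

lemma subgroup_pair_derived:
  assumes b: "b \<in> carrier G"
  shows "subgroup ((\<lambda>c. \<tau> c b) ` G') T"
proof -
  have "subgroup ((\<lambda>c. \<tau> c b) ` carrier (G\<lparr>carrier := G'\<rparr>)) T"
  proof (rule group_hom.img_is_subgroup)
    show "group_hom (G\<lparr>carrier := G'\<rparr>) T (\<lambda>c. \<tau> c b)"
      using G'.subgroup_is_group[OF G.is_group] b
      by (auto simp: group_hom_def group_hom_axioms_def hom_def pair_derived_mult T.m_comm)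
  qed
  then show ?thesis by simp
qed

text \<open>
  Splitting off one factor \<open>b\<close> conjugates the first entry by \<open>b\<close>, which stays in the derived subgroup but
  changes; hence the claim is membership in the set of all \<open>\<tau> c b\<close>.
\<close>

lemma pair_derived_pow:
  assumes b: "b \<in> carrier G" and "c \<in> G'"
  shows "\<tau> c (b [^] (j::nat)) \<in> (\<lambda>c. \<tau> c b) ` G'"
  using assms(2)
proof (induction j arbitrary: c)
  case 0
  then show ?case using subgroup.one_closed[OF subgroup_pair_derived[OF b]] by simp
next
  case (Suc j)
  have "conj_by G b c \<in> G'" using G'.inv_op_closed2[OF b Suc.prems] by (simp add: conj_by_def)
  then have "\<tau> (conj_by G b c) (b [^] j) \<in> (\<lambda>c. \<tau> c b) ` G'" by (rule Suc.IH)
  moreover have "conj_by G b (b [^] j) = b [^] j"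
    using b G.conj_by_eq_self_iff G.nat_pow_comm[of b 1 j] by simp
  moreover have "\<tau> c (b [^] Suc j) = \<tau> c b \<otimes>\<^bsub>T\<^esub> \<tau> (conj_by G b c) (conj_by G b (b [^] j))"
    unfolding G.nat_pow_Suc2[OF b] using b Suc.prems by (intro pair_mult_right) simp_all
  moreover have "\<tau> c b \<in> (\<lambda>c. \<tau> c b) ` G'" using Suc.prems by blast
  ultimately show ?case using subgroup.m_closed[OF subgroup_pair_derived[OF b]] by simp
qed

lemma pair_pow_pow:
  assumes b: "b \<in> carrier G"
  shows "\<tau> (b [^] (i::nat)) (b [^] (j::nat)) = \<tau> b b [^]\<^bsub>T\<^esub> (i * j)"
proof -
  have fix_pow: "conj_by G b (b [^] j) = b [^] j" for j :: nat
    using b G.conj_by_eq_self_iff G.nat_pow_comm[of b 1 j] by simp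
  have 1: "\<tau> b (b [^] j) = \<tau> b b [^]\<^bsub>T\<^esub> j" for j :: nat
  proof (induction j)
    case (Suc j)
    have "\<tau> b (b [^] Suc j) = \<tau> b b \<otimes>\<^bsub>T\<^esub> \<tau> b (b [^] j)"
      unfolding G.nat_pow_Suc2[OF b] using b pair_mult_right[of b b "b [^] j"] fix_pow[of j] fix_pow[of 1] by simp
    then show ?case using b Suc T.nat_pow_Suc2[of "\<tau> b b" j] by simp
  qed (use b in simp)
  show ?thesis
  proof (induction i)
    case (Suc i)
    have "\<tau> (b [^] Suc i) (b [^] j) = \<tau> (b [^] i) (b [^] j) \<otimes>\<^bsub>T\<^esub> \<tau> b (b [^] j)"
      unfolding G.nat_pow_Suc2[OF b] using b pair_mult_left[of b "b [^] i" "b [^] j"] fix_pow by simp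
    then show ?case using b by (simp add: Suc 1 T.nat_pow_mult add.commute)
  qed (use b in simp)
qed

text \<open>
  For \<open>g = c b^i\<close> and \<open>h = d b^j\<close> the symbol \<open>\<tau> g h\<close> is the product of \<open>\<tau> (b^i) d\<close>, \<open>\<tau> (b^i) (b^j)\<close>,
  \<open>\<tau> c d\<close> and \<open>\<tau> c (b^j)\<close>. The third factor is trivial, and the first is turned round by antisymmetry.
\<close>

lemma carrier_subset_pair_products:
  assumes b: "b \<in> carrier G"
    and gen: "\<forall>g\<in>carrier G. \<exists>c\<in>G'. \<exists>i::nat. g = c \<otimes> b [^] i"
  shows "carrier T \<subseteq> {u \<otimes>\<^bsub>T\<^esub> \<tau> b b [^]\<^bsub>T\<^esub> j | u j::int. u \<in> (\<lambda>c. \<tau> c b) ` G'}" (is "_ \<subseteq> ?W")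
proof (rule generated_by_pairs)
  let ?X = "(\<lambda>c. \<tau> c b) ` G'"
  interpret X: subgroup ?X T by (rule subgroup_pair_derived[OF b])
  have y: "\<tau> b b \<in> carrier T" using b by simp
  have WI: "t \<in> ?W" if "t = u \<otimes>\<^bsub>T\<^esub> \<tau> b b [^]\<^bsub>T\<^esub> j" "u \<in> ?X" for t u and j :: int
    using that by blast
  show "subgroup ?W T"
  proof (rule T.subgroupI)
    show "?W \<subseteq> carrier T" using X.mem_carrier y by blast
    show "?W \<noteq> {}" using X.one_closed by blast
  next
    fix t assume "t \<in> ?W"
    then obtain u and j :: int where t: "t = u \<otimes>\<^bsub>T\<^esub> \<tau> b b [^]\<^bsub>T\<^esub> j" "u \<in> ?X" by blast
    show "inv\<^bsub>T\<^esub> t \<in> ?W"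
    proof (rule WI)
      show "inv\<^bsub>T\<^esub> t = inv\<^bsub>T\<^esub> u \<otimes>\<^bsub>T\<^esub> \<tau> b b [^]\<^bsub>T\<^esub> (- j)"
        unfolding t(1) using X.mem_carrier[OF t(2)] y by (simp add: T.inv_mult T.int_pow_neg)
      show "inv\<^bsub>T\<^esub> u \<in> ?X" using t(2) by (rule X.m_inv_closed)
    qed
  next
    fix s t assume "s \<in> ?W" "t \<in> ?W"
    then obtain u v and i j :: int where st: "s = u \<otimes>\<^bsub>T\<^esub> \<tau> b b [^]\<^bsub>T\<^esub> i" "u \<in> ?X"
      "t = v \<otimes>\<^bsub>T\<^esub> \<tau> b b [^]\<^bsub>T\<^esub> j" "v \<in> ?X" by blast
    show "s \<otimes>\<^bsub>T\<^esub> t \<in> ?W"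
    proof (rule WI)
      show "s \<otimes>\<^bsub>T\<^esub> t = (u \<otimes>\<^bsub>T\<^esub> v) \<otimes>\<^bsub>T\<^esub> \<tau> b b [^]\<^bsub>T\<^esub> (i + j)"
        unfolding st using X.mem_carrier[OF st(2)] X.mem_carrier[OF st(4)] y
        by (simp add: T.int_pow_mult T.m_ac)
      show "u \<otimes>\<^bsub>T\<^esub> v \<in> ?X" using st(2,4) by (rule X.m_closed)
    qed
  qed
  fix g h assume g: "g \<in> carrier G" and h: "h \<in> carrier G"
  obtain c and i :: nat where c: "c \<in> G'" "g = c \<otimes> b [^] i" using gen g by blast
  obtain d and j :: nat where d: "d \<in> G'" "h = d \<otimes> b [^] j" using gen h by blast
  have bi: "b [^] i \<in> carrier G" "b [^] j \<in> carrier G" using b by simp_all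
  have cd: "c \<in> carrier G" "d \<in> carrier G" using c d by simp_all
  have anti: "\<tau> (b [^] i) d = inv\<^bsub>T\<^esub> \<tau> d (b [^] i)"
    using pair_derived_anticommute[OF d(1) bi(1)] T.m_comm[of "\<tau> d (b [^] i)" "\<tau> (b [^] i) d"] bi cd
    by (intro T.inv_equality[symmetric]) simp_all
  have "\<tau> g h = (\<tau> (b [^] i) d \<otimes>\<^bsub>T\<^esub> \<tau> (b [^] i) (b [^] j)) \<otimes>\<^bsub>T\<^esub> (\<tau> c d \<otimes>\<^bsub>T\<^esub> \<tau> c (b [^] j))"
    using pair_derived_mult(1)[OF c(1) bi(1) h] pair_derived_mult(2)[OF d(1) bi(2), of "b [^] i"]
      pair_derived_mult(2)[OF d(1) bi(2), of c] c(2) d(2) bi cd by simp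
  also have "\<dots> = (inv\<^bsub>T\<^esub> \<tau> d (b [^] i) \<otimes>\<^bsub>T\<^esub> \<tau> b b [^]\<^bsub>T\<^esub> (i * j)) \<otimes>\<^bsub>T\<^esub> \<tau> c (b [^] j)"
    using anti pair_derived_derived[OF c(1) d(1)] pair_pow_pow[OF b, of i j] cd bi by simp
  also have "\<dots> = (inv\<^bsub>T\<^esub> \<tau> d (b [^] i) \<otimes>\<^bsub>T\<^esub> \<tau> c (b [^] j)) \<otimes>\<^bsub>T\<^esub> \<tau> b b [^]\<^bsub>T\<^esub> int (i * j)"
    unfolding int_pow_int using cd bi y by (simp add: T.m_ac)
  finally show "\<tau> g h \<in> ?W"
    by (rule WI[OF _ X.m_closed[OF X.m_inv_closed[OF pair_derived_pow[OF b d(1)]] pair_derived_pow[OF b c(1)]]])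
qed

text \<open>
  The \<open>k\<close>-th power of \<open>\<tau> b b\<close> is \<open>\<tau> (b^k) b\<close>, which is again of the form \<open>\<tau> c b\<close>. So exponents of \<open>\<tau> b b\<close>
  matter only modulo \<open>k\<close>.
\<close>

lemma card_le_derived_times_index:
  assumes b: "b \<in> carrier G" and fin: "finite G'" and k: "k > 0" "b [^] (k::nat) \<in> G'"
    and gen: "\<forall>g\<in>carrier G. \<exists>c\<in>G'. \<exists>i::nat. g = c \<otimes> b [^] i"
  shows "finite (carrier T)" "card (carrier T) \<le> card G' * k"
proof -
  let ?X = "(\<lambda>c. \<tau> c b) ` G'"
  interpret X: subgroup ?X T by (rule subgroup_pair_derived[OF b])
  have y: "\<tau> b b \<in> carrier T" using b by simp
  have yk: "\<tau> b b [^]\<^bsub>T\<^esub> k \<in> ?X" 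
    using pair_pow_pow[OF b, of k 1] imageI[OF k(2), of "\<lambda>c. \<tau> c b"] b by simp
  let ?F = "\<lambda>(c, j). \<tau> c b \<otimes>\<^bsub>T\<^esub> \<tau> b b [^]\<^bsub>T\<^esub> j"
  have sub: "carrier T \<subseteq> ?F ` (G' \<times> {..<k})"
  proof
    fix t assume "t \<in> carrier T"
    then obtain u and j :: int where t: "t = u \<otimes>\<^bsub>T\<^esub> \<tau> b b [^]\<^bsub>T\<^esub> j" "u \<in> ?X"
      using carrier_subset_pair_products[OF b gen] by blast
    define q r where "q = j div int k" and "r = nat (j mod int k)"
    have r: "r < k" "j = int k * q + int r" using k(1) unfolding q_def r_def by (simp_all add: nat_less_iff)
    have "(\<tau> b b [^]\<^bsub>T\<^esub> k) [^]\<^bsub>T\<^esub> q \<in> ?X" using T.subgroup_int_pow_closed[OF X.subgroup_axioms yk] .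
    then have "u \<otimes>\<^bsub>T\<^esub> (\<tau> b b [^]\<^bsub>T\<^esub> k) [^]\<^bsub>T\<^esub> q \<in> ?X" using t(2) by (intro X.m_closed)
    then obtain c where c: "c \<in> G'" "u \<otimes>\<^bsub>T\<^esub> (\<tau> b b [^]\<^bsub>T\<^esub> k) [^]\<^bsub>T\<^esub> q = \<tau> c b" by blast
    have "\<tau> b b [^]\<^bsub>T\<^esub> j = (\<tau> b b [^]\<^bsub>T\<^esub> k) [^]\<^bsub>T\<^esub> q \<otimes>\<^bsub>T\<^esub> \<tau> b b [^]\<^bsub>T\<^esub> r"
      using T.int_pow_pow[OF y, of "int k" q] y unfolding r(2) by (simp add: T.int_pow_mult[OF y] int_pow_int)
    then have "t = \<tau> c b \<otimes>\<^bsub>T\<^esub> \<tau> b b [^]\<^bsub>T\<^esub> r"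
      unfolding t(1) c(2)[symmetric] using X.mem_carrier[OF t(2)] y by (simp add: T.m_assoc)
    then show "t \<in> ?F ` (G' \<times> {..<k})" using c(1) r(1) by force
  qed
  have f: "finite (G' \<times> {..<k})" using fin by simp
  show "finite (carrier T)" using sub f finite_surj by blast
  have "card (carrier T) \<le> card (G' \<times> {..<k})" using sub f surj_card_le by blast
  then show "card (carrier T) \<le> card G' * k"
    by (simp only: card_cartesian_product card_lessThan)
qed

end

section \<open>The tensor square\<close>

lemma presented_group_generated:
  assumes S: "subgroup S (presented_group X R)" and gens: "\<And>x. x \<in> X \<Longrightarrow> pres_class X R [gen x] \<in> S"
  shows "carrier (presented_group X R) \<subseteq> S"
proof -
  interpret P: group "presented_group X R" by (rule group_presented_group)
  interpret S: subgroup S "presented_group X R" by (rule S)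
  have letter: "pres_class X R [(b, x)] \<in> S" if x: "x \<in> X" for b x
  proof (cases b)
    case False
    have w: "[(False, x)] \<in> gwords X" "[gen x] \<in> gwords X" "[] \<in> gwords X" using x by (auto simp: gwords_def)
    have "pres_class X R [(False, x)] \<otimes>\<^bsub>presented_group X R\<^esub> pres_class X R [gen x] = \<one>\<^bsub>presented_group X R\<^esub>"
      unfolding mult_presented_group[OF w(1,2)] one_presented_group
      using pres_eq.cancel[OF x, of R False] pres_class_eq_iff[OF w(3)] by simp
    then have "pres_class X R [(False, x)] = inv\<^bsub>presented_group X R\<^esub> pres_class X R [gen x]"
      using w by (intro P.inv_equality[symmetric]) (auto simp: carrier_presented_group)
    then show ?thesis using False gens[OF x] by simp
  qed (use gens x in simp)
  have "pres_class X R w \<in> S" if "w \<in> gwords X" for w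
    using that
  proof (induction w)
    case Nil
    then show ?case using S.one_closed by (simp add: one_presented_group)
  next
    case (Cons a w)
    obtain b x where a: "a = (b, x)" by fastforce
    have w: "[(b, x)] \<in> gwords X" "w \<in> gwords X" "x \<in> X" using Cons.prems a by (auto simp: gwords_def)
    have "pres_class X R (a # w) = pres_class X R [(b, x)] \<otimes>\<^bsub>presented_group X R\<^esub> pres_class X R w"
      using mult_presented_group[OF w(1,2)] a by simp
    then show ?case using Cons.IH[OF w(2)] letter[OF w(3)] by simp
  qed
  then show ?thesis by (auto simp: carrier_presented_group)
qed

definition tensor :: "('a, 'b) monoid_scheme \<Rightarrow> 'a \<Rightarrow> 'a \<Rightarrow> ('a \<times> 'a) gword set" where
  "tensor G g h = pres_class (carrier G \<times> carrier G) (tensor_relations G) [gen (g, h)]"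

lemma tensor_square_universal:
  assumes "group H" and f: "\<And>g h. g \<in> carrier G \<Longrightarrow> h \<in> carrier G \<Longrightarrow> f g h \<in> carrier H"
    and l: "\<And>g' g h. g' \<in> carrier G \<Longrightarrow> g \<in> carrier G \<Longrightarrow> h \<in> carrier G \<Longrightarrow>
      f (g' \<otimes>\<^bsub>G\<^esub> g) h = f (conj_by G g' g) (conj_by G g' h) \<otimes>\<^bsub>H\<^esub> f g' h"
    and r: "\<And>g h' h. g \<in> carrier G \<Longrightarrow> h' \<in> carrier G \<Longrightarrow> h \<in> carrier G \<Longrightarrow>
      f g (h' \<otimes>\<^bsub>G\<^esub> h) = f g h' \<otimes>\<^bsub>H\<^esub> f (conj_by G h' g) (conj_by G h' h)"
    and "group G"
  obtains \<phi> where "\<phi> \<in> hom (tensor_square G) H"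
    "\<forall>g\<in>carrier G. \<forall>h\<in>carrier G. \<phi> (tensor G g h) = f g h"
proof -
  interpret H: group H by fact
  interpret G: group G by fact
  have "\<exists>\<phi>\<in>hom (presented_group (carrier G \<times> carrier G) (tensor_relations G)) H.
      \<forall>x\<in>carrier G \<times> carrier G.
        \<phi> (pres_class (carrier G \<times> carrier G) (tensor_relations G) [gen x]) = (case x of (g, h) \<Rightarrow> f g h)"
  proof (rule presented_group_universal[OF \<open>group H\<close>])
    show "(\<lambda>(g, h). f g h) \<in> carrier G \<times> carrier G \<rightarrow> carrier H" using f by auto
    fix u v assume "(u, v) \<in> tensor_relations G"
    then show "word_eval H (\<lambda>(g, h). f g h) u = word_eval H (\<lambda>(g, h). f g h) v"
      unfolding tensor_relations_def using f l r by (auto simp: G.conj_by_closed)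
  qed
  then obtain \<phi> where "\<phi> \<in> hom (tensor_square G) H"
    "\<forall>x\<in>carrier G \<times> carrier G. \<phi> (pres_class (carrier G \<times> carrier G) (tensor_relations G) [gen x]) = (case x of (g, h) \<Rightarrow> f g h)"
    unfolding tensor_square_def by blast
  then show ?thesis using that[of \<phi>] unfolding tensor_def by simp
qed

lemma tensor_square_commutator_pairing:
  assumes "group G"
  obtains \<kappa> where "commutator_pairing G (tensor_square G) (tensor G) \<kappa>"
proof -
  interpret G: group G by fact
  interpret T: group "tensor_square G" unfolding tensor_square_def by (rule group_presented_group)
  let ?X = "carrier G \<times> carrier G"
  have w: "[gen (g, h)] \<in> gwords ?X" if "g \<in> carrier G" "h \<in> carrier G" for g h
    using that by (simp add: gwords_def)
  have closed: "tensor G g h \<in> carrier (tensor_square G)" if "g \<in> carrier G" "h \<in> carrier G" for g h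
    unfolding tensor_def tensor_square_def carrier_presented_group using w[OF that] by blast
  have mult: "tensor G g h \<otimes>\<^bsub>tensor_square G\<^esub> tensor G g' h' =
      pres_class ?X (tensor_relations G) [gen (g, h), gen (g', h')]"
    if "g \<in> carrier G" "h \<in> carrier G" "g' \<in> carrier G" "h' \<in> carrier G" for g h g' h'
    unfolding tensor_def tensor_square_def using mult_presented_group[OF w w] that by simp
  have rel: "pres_class ?X (tensor_relations G) u = pres_class ?X (tensor_relations G) v"
    if "(u, v) \<in> tensor_relations G" for u v
    using presented_group_relation[OF that] tensor_relations_gwords[OF \<open>group G\<close> that] by blast
  have left: "tensor G (g' \<otimes>\<^bsub>G\<^esub> g) h = tensor G (conj_by G g' g) (conj_by G g' h) \<otimes>\<^bsub>tensor_square G\<^esub> tensor G g' h"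
    if "g' \<in> carrier G" "g \<in> carrier G" "h \<in> carrier G" for g' g h
  proof -
    have "([gen (g' \<otimes>\<^bsub>G\<^esub> g, h)], [gen (conj_by G g' g, conj_by G g' h), gen (g', h)]) \<in> tensor_relations G"
      unfolding tensor_relations_def using that by blast
    from rel[OF this] show ?thesis using that by (simp add: mult) (simp add: tensor_def)
  qed
  have right: "tensor G g (h' \<otimes>\<^bsub>G\<^esub> h) = tensor G g h' \<otimes>\<^bsub>tensor_square G\<^esub> tensor G (conj_by G h' g) (conj_by G h' h)"
    if "g \<in> carrier G" "h' \<in> carrier G" "h \<in> carrier G" for g h' h
  proof -
    have "([gen (g, h' \<otimes>\<^bsub>G\<^esub> h)], [gen (g, h'), gen (conj_by G h' g, conj_by G h' h)]) \<in> tensor_relations G"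
      unfolding tensor_relations_def using that by blast
    from rel[OF this] show ?thesis using that by (simp add: mult) (simp add: tensor_def)
  qed
  have gens: "carrier (tensor_square G) \<subseteq> S"
    if "subgroup S (tensor_square G)" "\<And>g h. g \<in> carrier G \<Longrightarrow> h \<in> carrier G \<Longrightarrow> tensor G g h \<in> S" for S
    using that unfolding tensor_square_def tensor_def by (intro presented_group_generated) auto
  have cl: "commutator G (g' \<otimes>\<^bsub>G\<^esub> g) h = commutator G (conj_by G g' g) (conj_by G g' h) \<otimes>\<^bsub>G\<^esub> commutator G g' h"
    if "g' \<in> carrier G" "g \<in> carrier G" "h \<in> carrier G" for g' g h
    using that by (simp add: conj_by_def G.m_assoc G.inv_mult_group G.mult_cancel_inner)
  have cr: "commutator G g (h' \<otimes>\<^bsub>G\<^esub> h) = commutator G g h' \<otimes>\<^bsub>G\<^esub> commutator G (conj_by G h' g) (conj_by G h' h)"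
    if "g \<in> carrier G" "h' \<in> carrier G" "h \<in> carrier G" for g h' h
    using that by (simp add: conj_by_def G.m_assoc G.inv_mult_group G.mult_cancel_inner)
  obtain \<kappa> where \<kappa>: "\<kappa> \<in> hom (tensor_square G) G"
    "\<forall>g\<in>carrier G. \<forall>h\<in>carrier G. \<kappa> (tensor G g h) = commutator G g h"
    using tensor_square_universal[OF \<open>group G\<close> _ cl cr \<open>group G\<close>] by auto
  have "commutator_pairing G (tensor_square G) (tensor G) \<kappa>"
    using closed left right gens \<kappa> by unfold_locales auto
  then show ?thesis by (rule that)
qed

lemma (in group) cyclic_group_iso_integer_mod_group:
  assumes fin: "finite (carrier G)" and cyc: "cyclic_group G"
  shows "G \<cong> integer_mod_group (order G)"
proof -
  define n where "n = order G"
  obtain x where x: "x \<in> carrier G" "carrier G = range (\<lambda>i::int. x [^] i)"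
    using cyc unfolding cyclic_group by blast
  have "generate G {x} = carrier G" using generate_pow[OF x(1)] x(2) by auto
  then have o: "ord x = n" using generate_pow_card[OF x(1)] by (simp add: n_def order_def)
  have n0: "n > 0" using fin order_gt_0_iff_finite by (simp add: n_def)
  have eq: "x [^] i = x [^] j \<longleftrightarrow> int n dvd j - i" for i j :: int using int_pow_eq[OF x(1), of i j] o by simp
  have md: "x [^] (i mod int n) = x [^] i" for i :: int by (simp add: eq dvd_minus_mod)
  have carr: "carrier (integer_mod_group n) = {0..<int n}" using n0 by (simp add: carrier_integer_mod_group)
  have "(\<lambda>i. x [^] i) \<in> iso (integer_mod_group n) G"
  proof (rule isoI)
    show "(\<lambda>i. x [^] i) \<in> hom (integer_mod_group n) G"
      using x(1) by (intro homI) (simp_all add: md int_pow_mult)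
    have "inj_on (\<lambda>i. x [^] i) {0..<int n}"
    proof (rule inj_onI)
      fix i j assume ij: "i \<in> {0..<int n}" "j \<in> {0..<int n}" "x [^] i = x [^] j"
      then have "int n dvd j - i" by (simp add: eq)
      then have "j mod int n = i mod int n" by (simp only: mod_eq_dvd_iff)
      then show "i = j" using ij by simp
    qed
    moreover have "(\<lambda>i. x [^] i) ` {0..<int n} = carrier G"
    proof
      show "carrier G \<subseteq> (\<lambda>i. x [^] i) ` {0..<int n}"
      proof
        fix g assume "g \<in> carrier G"
        then obtain i :: int where "g = x [^] i" using x(2) by blast
        then have "g = x [^] (i mod int n)" by (simp add: md)
        then show "g \<in> (\<lambda>i. x [^] i) ` {0..<int n}" using n0 by simp
      qed
    qed (use x(1) in auto)
    ultimately show "bij_betw (\<lambda>i. x [^] i) (carrier (integer_mod_group n)) (carrier G)"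
      unfolding bij_betw_def carr by blast
  qed
  then have "integer_mod_group n \<cong> G" by (auto simp: is_iso_def)
  then show ?thesis using group.iso_sym[OF group_integer_mod_group] by (simp add: n_def)
qed

lemma (in group_hom) order_dvd_if_surj:
  assumes "h ` carrier G = carrier H"
  shows "order H dvd order G"
proof -
  have "order (G Mod kernel G H h) = order H"
    using FactGroup_iso[OF assms] iso_same_card by (auto simp: order_def)
  then show ?thesis using G.lagrange[OF subgroup_kernel]
    by (simp add: FactGroup_def order_def) (metis dvd_triv_left)
qed

text \<open>
  The ring multiplication modulo \<open>k\<close> is bilinear, and \<open>\<theta>\<close> does not see conjugation, so
  \<open>(g, h) \<mapsto> \<theta> g \<theta> h\<close> respects the relations of the tensor square. Choosing \<open>b\<close> with \<open>\<theta> b = 1\<close> shows that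
  the induced map is onto.
\<close>

lemma order_tensor_square_dvd_if_hom_integer_mod:
  assumes "group G" and \<theta>: "\<theta> \<in> hom G (integer_mod_group k)"
    and surj: "\<theta> ` carrier G = carrier (integer_mod_group k)" and k: "k > 0"
  shows "k dvd order (tensor_square G)"
proof -
  interpret G: group G by fact
  interpret T: group "tensor_square G" unfolding tensor_square_def by (rule group_presented_group)
  let ?Z = "integer_mod_group k"
  have Zc: "carrier ?Z = {0..<int k}" using k by (simp add: carrier_integer_mod_group)
  interpret Z: comm_group ?Z by simp
  interpret \<theta>: group_hom G ?Z \<theta> using \<theta> by unfold_locales
  have conj: "\<theta> (conj_by G x y) = \<theta> y" if "x \<in> carrier G" "y \<in> carrier G" for x y
  proof -
    have "\<theta> (conj_by G x y) = \<theta> x \<otimes>\<^bsub>?Z\<^esub> \<theta> y \<otimes>\<^bsub>?Z\<^esub> inv\<^bsub>?Z\<^esub> \<theta> x"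
      unfolding conj_by_def using that by (simp only: \<theta>.hom_mult \<theta>.hom_inv G.m_closed G.inv_closed)
    also have "\<dots> = \<theta> y" using that \<theta>.hom_closed by (metis Z.inv_closed Z.m_assoc Z.m_comm Z.r_inv Z.r_one Z.m_closed)
    finally show ?thesis .
  qed
  define f where "f g h = (\<theta> g * \<theta> h) mod int k" for g h
  have f_left: "f (g' \<otimes>\<^bsub>G\<^esub> g) h = f (conj_by G g' g) (conj_by G g' h) \<otimes>\<^bsub>?Z\<^esub> f g' h"
    if "g' \<in> carrier G" "g \<in> carrier G" "h \<in> carrier G" for g' g h
    using that \<theta>.hom_mult[of g' g] unfolding f_def by (simp add: conj mod_simps algebra_simps)
  have f_right: "f g (h' \<otimes>\<^bsub>G\<^esub> h) = f g h' \<otimes>\<^bsub>?Z\<^esub> f (conj_by G h' g) (conj_by G h' h)"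
    if "g \<in> carrier G" "h' \<in> carrier G" "h \<in> carrier G" for g h' h
    using that \<theta>.hom_mult[of h' h] unfolding f_def by (simp add: conj mod_simps algebra_simps)
  have f_closed: "f g h \<in> carrier ?Z" for g h unfolding f_def Zc using k by simp
  obtain \<phi> where \<phi>: "\<phi> \<in> hom (tensor_square G) ?Z"
    "\<forall>g\<in>carrier G. \<forall>h\<in>carrier G. \<phi> (tensor G g h) = f g h"
    using tensor_square_universal[OF Z.is_group f_closed f_left f_right \<open>group G\<close>] .
  interpret \<phi>: group_hom "tensor_square G" ?Z \<phi> using \<phi>(1) by unfold_locales
  obtain \<kappa> where "commutator_pairing G (tensor_square G) (tensor G) \<kappa>"
    using tensor_square_commutator_pairing[OF \<open>group G\<close>] .
  then interpret P: commutator_pairing G "tensor_square G" "tensor G" \<kappa> .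
  \<comment> \<open>For \<open>k = 1\<close> the residue of \<open>1\<close> is \<open>0\<close>.\<close>
  have "1 mod int k \<in> carrier ?Z" using k by (simp add: Zc)
  then obtain b where b: "b \<in> carrier G" "\<theta> b = 1 mod int k" using surj by (metis imageE)
  have "\<phi> ` carrier (tensor_square G) = carrier ?Z"
  proof
    show "carrier ?Z \<subseteq> \<phi> ` carrier (tensor_square G)"
    proof
      fix r assume r: "r \<in> carrier ?Z"
      then obtain g where g: "g \<in> carrier G" "\<theta> g = r" using surj by (metis imageE)
      have "\<phi> (tensor G b g) = r" using \<phi>(2) b g r Zc by (simp add: f_def mod_simps)
      then show "r \<in> \<phi> ` carrier (tensor_square G)" using P.pair_closed[OF b(1) g(1)] by blast
    qed
  qed auto
  then have "order ?Z dvd order (tensor_square G)" by (rule \<phi>.order_dvd_if_surj)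
  then show ?thesis by (simp add: order_def Zc)
qed

theorem theoremA:
  fixes G :: "('a, 'b) monoid_scheme" and n :: nat
  assumes "group G" and "order G = n" and "n > 0" and "squarefree n"
  shows "tensor_square G \<cong> integer_mod_group n"
proof -
  interpret G: group G by fact
  let ?T = "tensor_square G" let ?D = "derived G (carrier G)" let ?Q = "G Mod derived G (carrier G)"
  have fin: "finite (carrier G)" and sq: "squarefree (order G)"
    using assms G.order_gt_0_iff_finite by auto
  obtain \<kappa> where \<kappa>: "commutator_pairing G ?T (tensor G) \<kappa>"
    using tensor_square_commutator_pairing[OF \<open>group G\<close>] .
  interpret P: commutator_pairing G ?T "tensor G" \<kappa> by (rule \<kappa>)
  have finD: "finite ?D" using fin P.G'.subset finite_subset by blast
  have "comm_group (G\<lparr>carrier := ?D\<rparr>)" using squarefree_order_imp_derived_comm[OF \<open>group G\<close> fin sq] .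
  then have "cyclic_group (G\<lparr>carrier := ?D\<rparr>)"
    using finD G.squarefree_order_subgroup[OF sq P.subgroup_derived]
    by (intro comm_group.squarefree_order_imp_cyclic) simp_all
  then have T_comm: "comm_group ?T" by (rule P.comm_group_if_derived_cyclic)
  interpret A: abelian_commutator_pairing G ?T "tensor G" \<kappa>
    using \<kappa> T_comm by (simp add: abelian_commutator_pairing_def abelian_commutator_pairing_axioms_def)
  define k where "k = order ?Q"
  have km: "k * card ?D = n"
    using G.lagrange[OF P.subgroup_derived] assms(2) by (simp add: k_def order_def FactGroup_def)
  have k0: "k > 0" using km assms(3) by (cases k) auto
  interpret Q: group ?Q by (rule P.G'.factorgroup_is_group)
  have finQ: "finite (carrier ?Q)" using k0 Q.order_gt_0_iff_finite by (simp add: k_def)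
  have cycQ: "cyclic_group ?Q" using G.squarefree_order_imp_abelianization_cyclic[OF fin sq] .
  interpret q: group_hom G ?Q "\<lambda>g. ?D #>\<^bsub>G\<^esub> g"
    by unfold_locales (rule P.G'.r_coset_hom_Mod)
  have q_surj: "(\<lambda>g. ?D #>\<^bsub>G\<^esub> g) ` carrier G = carrier ?Q" by (auto simp: FactGroup_def RCOSETS_def)
  have q_ker: "g \<in> ?D" if "g \<in> carrier G" "?D #>\<^bsub>G\<^esub> g = \<one>\<^bsub>?Q\<^esub>" for g
    using G.coset_join1[OF _ that(1) P.subgroup_derived] that(2) by (simp add: FactGroup_def)

  have k_dvd: "k dvd order ?T"
  proof -
    obtain \<psi> where \<psi>: "\<psi> \<in> iso ?Q (integer_mod_group k)"
      using Q.cyclic_group_iso_integer_mod_group[OF finQ cycQ] by (auto simp: is_iso_def k_def)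
    have "\<psi> \<circ> (\<lambda>g. ?D #>\<^bsub>G\<^esub> g) \<in> hom G (integer_mod_group k)"
      using \<psi> q.homh by (intro hom_compose) (auto simp: iso_def)
    moreover have "(\<psi> \<circ> (\<lambda>g. ?D #>\<^bsub>G\<^esub> g)) ` carrier G = carrier (integer_mod_group k)"
      using \<psi> unfolding image_comp[symmetric] q_surj by (auto simp: iso_def bij_betw_def)
    ultimately show ?thesis using order_tensor_square_dvd_if_hom_integer_mod[OF \<open>group G\<close> _ _ k0] by blast
  qed
  have "card ?D dvd order ?T"
    using group_hom.order_dvd_if_surj[OF P.kappa_hom_derived] P.kappa_image by (simp add: order_def)
  moreover have "coprime k (card ?D)"
  proof -
    have "gcd k (card ?D) ^ 2 dvd n" unfolding power2_eq_square km[symmetric] by (intro mult_dvd_mono) simp_all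
    then have "gcd k (card ?D) dvd 1" using assms(4) unfolding squarefree_def by blast
    then show ?thesis by (simp add: coprime_iff_gcd_eq_1)
  qed
  ultimately have n_dvd: "n dvd order ?T" using k_dvd divides_mult km by metis

  \<comment> \<open>A generator of the abelianization lifts to an element \<open>b\<close> whose powers represent all cosets.\<close>
  obtain z where z: "z \<in> carrier ?Q" "carrier ?Q = range (\<lambda>i::int. z [^]\<^bsub>?Q\<^esub> i)"
    using cycQ unfolding Q.cyclic_group by blast
  obtain b where b: "b \<in> carrier G" "?D #>\<^bsub>G\<^esub> b = z" using q_surj z(1) by (metis imageE)
  have bk: "b [^]\<^bsub>G\<^esub> k \<in> ?D"
    using b q.hom_nat_pow[OF b(1), of k] Q.pow_order_eq_1[OF z(1)] by (intro q_ker) (simp_all add: k_def)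
  have gen: "\<forall>g\<in>carrier G. \<exists>c\<in>?D. \<exists>i::nat. g = c \<otimes>\<^bsub>G\<^esub> b [^]\<^bsub>G\<^esub> i"
  proof
    fix g assume g: "g \<in> carrier G"
    then obtain i :: int where "?D #>\<^bsub>G\<^esub> g = z [^]\<^bsub>?Q\<^esub> i" using q_surj z(2) by blast
    also have "\<dots> = z [^]\<^bsub>?Q\<^esub> (i mod int k)"
    proof -
      have "int (Q.ord z) dvd int k" using Q.ord_dvd_group_order[OF z(1)] by (simp add: k_def)
      also have "int k dvd i mod int k - i" using dvd_minus_mod[of "int k" i] dvd_diff_commute by blast
      finally show ?thesis using Q.int_pow_eq[OF z(1)] by simp
    qed
    also have "\<dots> = z [^]\<^bsub>?Q\<^esub> nat (i mod int k)" using k0 by (simp flip: int_pow_int)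
    finally have i: "?D #>\<^bsub>G\<^esub> g = z [^]\<^bsub>?Q\<^esub> nat (i mod int k)" .
    let ?p = "b [^]\<^bsub>G\<^esub> nat (i mod int k)"
    have p: "?p \<in> carrier G" using b(1) by simp
    have "?D #>\<^bsub>G\<^esub> ?p = ?D #>\<^bsub>G\<^esub> g" using q.hom_nat_pow[OF b(1)] b(2) i by simp
    then have "?D #>\<^bsub>G\<^esub> (g \<otimes>\<^bsub>G\<^esub> inv\<^bsub>G\<^esub> ?p) =
        (?D #>\<^bsub>G\<^esub> g) \<otimes>\<^bsub>?Q\<^esub> inv\<^bsub>?Q\<^esub> (?D #>\<^bsub>G\<^esub> g)"
      using q.hom_mult[OF g G.inv_closed[OF p]] q.hom_inv[OF p] by (simp only:)
    also have "\<dots> = \<one>\<^bsub>?Q\<^esub>" by (rule Q.r_inv[OF q.hom_closed[OF g]])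
    finally have "g \<otimes>\<^bsub>G\<^esub> inv\<^bsub>G\<^esub> ?p \<in> ?D" using g p by (intro q_ker) simp_all
    moreover have "g = (g \<otimes>\<^bsub>G\<^esub> inv\<^bsub>G\<^esub> ?p) \<otimes>\<^bsub>G\<^esub> ?p" using g p by (simp add: G.m_assoc)
    ultimately show "\<exists>c\<in>?D. \<exists>i::nat. g = c \<otimes>\<^bsub>G\<^esub> b [^]\<^bsub>G\<^esub> i" by blast
  qed
  have finT: "finite (carrier ?T)" and "card (carrier ?T) \<le> n"
    using A.card_le_derived_times_index[OF b(1) finD k0 bk gen] km by (simp_all add: mult.commute)
  moreover have "order ?T > 0" using finT P.T.order_gt_0_iff_finite by blast
  ultimately have "order ?T = n" using n_dvd dvd_imp_le by (fastforce simp: order_def)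
  then have "cyclic_group ?T" using A.T.squarefree_order_imp_cyclic finT assms(4) by simp
  then show ?thesis
    using P.T.cyclic_group_iso_integer_mod_group[OF finT] \<open>order ?T = n\<close> by simp
qed

end
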